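(* Let $\mathcal H$ be an infinite-dimensional separable complex Hilbert space, let $C\in\mathcal B^1(\mathcal H)$ and $T\in\mathcal B(\mathcal H)$. Then $\overline{W_C(T)}$ is star-shaped with respect to $\operatorname{tr}(C)W_e(T)$, i.e. every $z\in\operatorname{tr}(C)W_e(T)=\{\operatorname{tr}(C)\mu\mid\mu\in W_e(T)\}$ is a star-center of $\overline{W_C(T)}$.
   Context: $\mathcal B(\mathcal H)$ denotes the bounded linear operators on $\mathcal H$ and $\mathcal B^1(\mathcal H)$ the trace-class operators on $\mathcal H$. The $C$-numerical range of $T$ is $W_C(T):=\{\operatorname{tr}(CU^\dagger TU)\mid U\in\mathcal B(\mathcal H)\text{ unitary}\}\subset\mathbb C$, and $\overline{W_C(T)}$ is its closure. The essential numerical range of $T$ is $W_e(T):=\{\lim_{n\to\infty}\langle f_n,Tf_n\rangle\mid (f_n)_{n\in\mathbb N}\text{ is an orthonormal system in }\mathcal H\}$, i.e. the set of all limits arising from orthonormal sequences for which the limit exists. The scalar product is conjugate linear in the first and linear in the second argument. A set $A\subseteq\mathbb C$ is star-shaped with respect to $z\in\mathbb C$ (and $z$ is a star-center of $A$) if $tz+(1-t)a\in A$ for all $a\in A$ and $t\in[0,1]$. *)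

theory Defs
  imports "HOL-Analysis.Analysis"
begin

section \<open>Complex Hilbert spaces\<close>

text \<open>
  The scalar product is conjugate linear in the first and linear in the second argument.
  The real Banach space structure (norm, topology, completeness) is inherited from \<^class>\<open>banach\<close>;
  the axioms \<open>scaleR_scaleC\<close> and \<open>norm_eq_sqrt_cinner\<close> tie it to the complex structure.
\<close>

class complex_hilbert_space = banach +
  fixes scaleC :: "complex \<Rightarrow> 'a \<Rightarrow> 'a"  (infixr \<open>*\<^sub>C\<close> 75)
    and cinner :: "'a \<Rightarrow> 'a \<Rightarrow> complex"
  assumes scaleC_add_right: "a *\<^sub>C (x + y) = a *\<^sub>C x + a *\<^sub>C y"
    and scaleC_add_left: "(a + b) *\<^sub>C x = a *\<^sub>C x + b *\<^sub>C x"
    and scaleC_scaleC: "a *\<^sub>C (b *\<^sub>C x) = (a * b) *\<^sub>C x"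
    and scaleC_one: "1 *\<^sub>C x = x"
    and scaleR_scaleC: "scaleR r x = complex_of_real r *\<^sub>C x"
    and cinner_commute: "cinner x y = cnj (cinner y x)"
    and cinner_add_right: "cinner x (y + z) = cinner x y + cinner x z"
    and cinner_scaleC_right: "cinner x (a *\<^sub>C y) = a * cinner x y"
    and cinner_ge_zero: "cinner x x \<in> \<real>\<^sub>\<ge>\<^sub>0"
    and cinner_eq_zero_iff: "cinner x x = 0 \<longleftrightarrow> x = 0"
    and norm_eq_sqrt_cinner: "norm x = sqrt (Re (cinner x x))"

global_interpretation complex_vector:
  vector_space "scaleC :: complex \<Rightarrow> 'a \<Rightarrow> 'a::complex_hilbert_space"
  by unfold_locales (simp_all add: scaleC_add_right scaleC_add_left scaleC_scaleC scaleC_one)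

definition cinfinite_dimensional :: "'a::complex_hilbert_space itself \<Rightarrow> bool" where
  "cinfinite_dimensional _ \<longleftrightarrow>
     \<not> (\<exists>S :: 'a set. finite S \<and> complex_vector.span S = UNIV)"

definition orthonormal_set :: "'a::complex_hilbert_space set \<Rightarrow> bool" where
  "orthonormal_set B \<longleftrightarrow> (\<forall>x\<in>B. \<forall>y\<in>B. cinner x y = (if x = y then 1 else 0))"

definition orthonormal_basis :: "'a::complex_hilbert_space set \<Rightarrow> bool" where
  "orthonormal_basis B \<longleftrightarrow>
     orthonormal_set B \<and> closure (complex_vector.span B) = UNIV"

definition orthonormal_sequence :: "(nat \<Rightarrow> 'a::complex_hilbert_space) \<Rightarrow> bool" where
  "orthonormal_sequence f \<longleftrightarrow> (\<forall>m n. cinner (f m) (f n) = (if m = n then 1 else 0))"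


section \<open>Operators\<close>

definition bounded_op :: "('a::complex_hilbert_space \<Rightarrow> 'a) \<Rightarrow> bool" where
  "bounded_op T \<longleftrightarrow>
     Vector_Spaces.linear scaleC scaleC T \<and> (\<exists>K. \<forall>x. norm (T x) \<le> K * norm x)"

text \<open>Meaningful for bounded operators, where the Riesz theorem gives a unique adjoint.\<close>

definition adj :: "('a::complex_hilbert_space \<Rightarrow> 'a) \<Rightarrow> ('a \<Rightarrow> 'a)" where
  "adj T = (THE S. \<forall>x y. cinner (S x) y = cinner x (T y))"

definition unitary_op :: "('a::complex_hilbert_space \<Rightarrow> 'a) \<Rightarrow> bool" where
  "unitary_op U \<longleftrightarrow> bounded_op U \<and> adj U \<circ> U = id \<and> U \<circ> adj U = id"

definition positive_op :: "('a::complex_hilbert_space \<Rightarrow> 'a) \<Rightarrow> bool" where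
  "positive_op P \<longleftrightarrow> bounded_op P \<and> (\<forall>x. cinner x (P x) \<in> \<real>\<^sub>\<ge>\<^sub>0)"

text \<open>\<open>P = |A|\<close>, i.e. \<open>P\<close> is the positive square root of \<open>A\<^sup>\<dagger>A\<close>.\<close>

definition is_abs_op :: "('a::complex_hilbert_space \<Rightarrow> 'a) \<Rightarrow> ('a \<Rightarrow> 'a) \<Rightarrow> bool" where
  "is_abs_op A P \<longleftrightarrow> positive_op P \<and> P \<circ> P = adj A \<circ> A"

text \<open>
  \<open>A\<close> is trace class iff \<open>tr |A| = \<Sum>\<^sub>e \<langle>e, |A| e\<rangle> < \<infinity>\<close>. As \<open>|A|\<close> is positive, the value of the
  sum does not depend on the orthonormal basis, so it is enough to ask for one.
\<close>

definition trace_class :: "('a::complex_hilbert_space \<Rightarrow> 'a) \<Rightarrow> bool" where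
  "trace_class A \<longleftrightarrow> bounded_op A \<and>
     (\<exists>P B. is_abs_op A P \<and> orthonormal_basis B \<and> (\<lambda>e. cinner e (P e)) summable_on B)"

text \<open>
  For trace-class operators the sum converges absolutely and does not depend on the
  orthonormal basis; the definition is only meaningful for those.
\<close>

definition trace_op :: "('a::complex_hilbert_space \<Rightarrow> 'a) \<Rightarrow> complex" where
  "trace_op A = (\<Sum>\<^sub>\<infinity>e\<in>(SOME B. orthonormal_basis B). cinner e (A e))"


section \<open>Numerical ranges and star-shapedness\<close>

definition C_numerical_range ::
  "('a::complex_hilbert_space \<Rightarrow> 'a) \<Rightarrow> ('a \<Rightarrow> 'a) \<Rightarrow> complex set" where
  "C_numerical_range C T = {trace_op (C \<circ> adj U \<circ> T \<circ> U) | U. unitary_op U}"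

definition essential_numerical_range ::
  "('a::complex_hilbert_space \<Rightarrow> 'a) \<Rightarrow> complex set" where
  "essential_numerical_range T =
     {\<mu>. \<exists>f. orthonormal_sequence f \<and> (\<lambda>n. cinner (f n) (T (f n))) \<longlonglongrightarrow> \<mu>}"

definition star_shaped_wrt :: "complex set \<Rightarrow> complex \<Rightarrow> bool" where
  "star_shaped_wrt A z \<longleftrightarrow>
     (\<forall>a\<in>A. \<forall>t\<in>{0..1::real}. complex_of_real t * z + complex_of_real (1 - t) * a \<in> A)"

end

theory Submission
  imports Defs
begin

text \<open>
  Points \<open>tr(C U\<^sup>\<dagger> T U)\<close> are dense in the closed \<open>C\<close>-numerical range, and \<open>W\<^sub>e(T)\<close> and \<open>W\<^sub>C(T)\<close> do not
  change if \<open>T\<close> is replaced by \<open>U\<^sup>\<dagger> T U\<close>. So it is enough to show that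
  \<open>t \<mu> tr(C) + (1 - t) tr(CT)\<close> lies in the closure of \<open>W\<^sub>C(T)\<close> for every \<open>\<mu> \<in> W\<^sub>e(T)\<close>. This number is
  \<open>tr(C S)\<close> for \<open>S = (1 - t) T + t \<mu>\<close>, and it suffices to approximate \<open>S\<close> in the weak
  operator topology by operators \<open>V\<^sub>n\<^sup>\<dagger> T V\<^sub>n\<close> with \<open>V\<^sub>n\<close> unitary, because \<open>A \<mapsto> tr(CA)\<close> is weakly
  continuous on bounded sets (\<open>trace_op_weakly_continuous\<close>).

  The unitaries are explicit. Let \<open>b\<close> be an orthonormal basis. A sequence that realizes \<open>\<mu>\<close> tends
  weakly to zero, so slight perturbations of vectors far out in it are orthonormal \<open>g\<^sub>0, \<dots>, g\<^sub>n\<^sub>-\<^sub>1\<close>, orthogonal to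
  \<open>b\<^sub>0, \<dots>, b\<^sub>n\<^sub>-\<^sub>1\<close>, with \<open>\<langle>g\<^sub>i, T g\<^sub>i\<rangle>\<close> close to \<open>\<mu>\<close> and with all of \<open>\<langle>g\<^sub>i, T g\<^sub>j\<rangle>\<close> for \<open>i \<noteq> j\<close>,
  \<open>\<langle>b\<^sub>i, T g\<^sub>j\<rangle>\<close> and \<open>\<langle>g\<^sub>i, T b\<^sub>j\<rangle>\<close> close to zero (\<open>essential_directions\<close>). A product of plane rotations
  sends \<open>b\<^sub>i\<close> to \<open>\<surd>(1 - t) b\<^sub>i + \<surd>t g\<^sub>i\<close> for all \<open>i < n\<close>, and conjugating \<open>T\<close> by it gives the
  leading matrix entries of \<open>S\<close> up to a small error (\<open>rotated_matrix_entries\<close>).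

  Weak continuity of the trace rests on a decomposition \<open>C = \<Sum>\<^sub>k |s\<^sub>k\<rangle>\<langle>r\<^sub>k|\<close> with
  \<open>\<parallel>s\<^sub>k\<parallel> = \<parallel>r\<^sub>k\<parallel>\<close> square summable (\<open>nuclear_decomposition\<close>), which gives
  \<open>tr(CA) = \<Sum>\<^sub>k \<langle>r\<^sub>k, A s\<^sub>k\<rangle>\<close> for bounded \<open>A\<close> (\<open>trace_op_decomposition\<close>).
\<close>

section \<open>Inner products and adjoints\<close>

lemma bounded_op_add: "bounded_op T \<Longrightarrow> T (x + y) = T x + T y"
  and bounded_op_scaleC: "bounded_op T \<Longrightarrow> T (a *\<^sub>C x) = a *\<^sub>C T x"
  by (simp_all add: bounded_op_def Vector_Spaces.linear_iff)

lemma bounded_opI: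
  assumes "\<And>x y. T (x + y) = T x + T y" "\<And>a x. T (a *\<^sub>C x) = a *\<^sub>C T x"
    and "\<And>x. norm (T x) \<le> K * norm x"
  shows "bounded_op (T :: 'a::complex_hilbert_space \<Rightarrow> 'a)"
  unfolding bounded_op_def Vector_Spaces.linear_iff
  using assms complex_vector.vector_space_axioms by blast

lemma bounded_op_bound:
  assumes "bounded_op (T :: 'a::complex_hilbert_space \<Rightarrow> 'a)"
  shows "\<exists>K\<ge>0. \<forall>x. norm (T x) \<le> K * norm x"
proof -
  obtain K where K: "\<And>x. norm (T x) \<le> K * norm x"
    using assms unfolding bounded_op_def by blast
  have "norm (T x) \<le> max K 0 * norm x" for x
    using K[of x] mult_right_mono[of K "max K 0" "norm x"] by simp
  then show ?thesis by (intro exI[of _ "max K 0"]) simp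
qed

lemma bounded_op_linear:
  assumes "bounded_op (T :: 'a::complex_hilbert_space \<Rightarrow> 'a)"
  shows "bounded_linear T"
proof -
  obtain K where "0 \<le> K" "\<And>x. norm (T x) \<le> K * norm x" using bounded_op_bound[OF assms] by blast
  then show ?thesis
    by (intro bounded_linear_intro[of T K])
       (simp_all add: bounded_op_add[OF assms] bounded_op_scaleC[OF assms] scaleR_scaleC mult.commute)
qed

lemma cinner_add_left: "cinner (x + y) z = cinner x z + cinner y z"
  by (subst (1 2 3) cinner_commute) (simp add: cinner_add_right)

lemma cinner_scaleC_left: "cinner (a *\<^sub>C x) y = cnj a * cinner x y"
  by (subst (1 2) cinner_commute) (simp add: cinner_scaleC_right)

lemma cinner_self: "cinner x x = complex_of_real ((norm x)\<^sup>2)"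
proof -
  have "Re (cinner x x) \<ge> 0" "Im (cinner x x) = 0"
    using cinner_ge_zero[of x] by (auto simp: complex_nonneg_Reals_iff)
  then show ?thesis
    by (simp add: norm_eq_sqrt_cinner complex_eq_iff)
qed

lemma norm_scaleC: "norm (a *\<^sub>C x) = cmod a * norm (x :: 'a::complex_hilbert_space)"
proof -
  have "complex_of_real ((norm (a *\<^sub>C x))\<^sup>2) = complex_of_real ((cmod a * norm x)\<^sup>2)"
    unfolding cinner_self[symmetric] cinner_scaleC_left cinner_scaleC_right
    by (simp add: cinner_self complex_norm_square power_mult_distrib mult_ac del: of_real_power)
  then have "(norm (a *\<^sub>C x))\<^sup>2 = (cmod a * norm x)\<^sup>2"
    using of_real_eq_iff by blast
  then show ?thesis by (simp add: power2_eq_iff_nonneg)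
qed

lemma positive_op_real:
  assumes "positive_op Q"
  shows "Im (cinner x (Q x)) = 0" "Re (cinner x (Q x)) \<ge> 0"
  using assms unfolding positive_op_def by (auto simp: complex_nonneg_Reals_iff)

text \<open>Over the complex numbers a form with real diagonal is Hermitian, by polarization with
  \<open>x + y\<close> and \<open>x + \<i>y\<close>.\<close>

lemma positive_op_hermitian:
  assumes "positive_op Q"
  shows "cinner (Q x) y = cinner x (Q y)"
proof -
  have Q: "bounded_op Q" using assms by (simp add: positive_op_def)
  have *: "Im (a * cinner x (Q y) + cnj a * cinner y (Q x)) = 0" for a
  proof -
    have "cinner (x + a *\<^sub>C y) (Q (x + a *\<^sub>C y)) = cinner x (Q x)
        + (a * cinner x (Q y) + cnj a * cinner y (Q x)) + cinner (a *\<^sub>C y) (Q (a *\<^sub>C y))"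
      by (simp add: bounded_op_add[OF Q] bounded_op_scaleC[OF Q] cinner_add_left cinner_add_right
        cinner_scaleC_left cinner_scaleC_right algebra_simps)
    then show ?thesis
      using positive_op_real(1)[OF assms, of x] positive_op_real(1)[OF assms, of "a *\<^sub>C y"]
        positive_op_real(1)[OF assms, of "x + a *\<^sub>C y"] by simp
  qed
  have "cinner x (Q y) = cnj (cinner y (Q x))"
    using *[of 1] *[of \<i>] by (simp add: complex_eq_iff)
  then show ?thesis by (metis cinner_commute)
qed

text \<open>The form \<open>\<langle>x, Qy\<rangle>\<close> is nonnegative on \<open>x - s \<beta>\<^sup>* y\<close> for all real \<open>s\<close>, where
  \<open>\<beta> = \<langle>x, Qy\<rangle>\<close>. This is a quadratic inequality in \<open>s\<close>, which degenerates to a linear one and forces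
  \<open>\<beta> = 0\<close> if \<open>\<langle>y, Qy\<rangle> = 0\<close>.\<close>

lemma positive_op_Cauchy_Schwarz:
  assumes "positive_op Q"
  shows "(cmod (cinner x (Q y)))\<^sup>2 \<le> Re (cinner x (Q x)) * Re (cinner y (Q y))"
proof -
  have Q: "bounded_op Q" using assms by (simp add: positive_op_def)
  define \<beta> where "\<beta> = cinner x (Q y)"
  define c where "c = Re (cinner y (Q y))"
  have \<beta>': "cinner y (Q x) = cnj \<beta>"
    by (metis \<beta>_def assms cinner_commute positive_op_hermitian)
  have quad: "0 \<le> Re (cinner x (Q x)) - 2 * s * (cmod \<beta>)\<^sup>2 + s\<^sup>2 * (cmod \<beta>)\<^sup>2 * c" for s :: real
  proof -
    define a where "a = - (complex_of_real s * cnj \<beta>)"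
    have "0 \<le> Re (cinner (x + a *\<^sub>C y) (Q (x + a *\<^sub>C y)))"
      using positive_op_real[OF assms] by blast
    also have "cinner (x + a *\<^sub>C y) (Q (x + a *\<^sub>C y))
        = cinner x (Q x) + a * \<beta> + cnj (a * \<beta>) + (a * cnj a) * cinner y (Q y)"
      by (simp add: bounded_op_add[OF Q] bounded_op_scaleC[OF Q] cinner_add_left cinner_add_right
        cinner_scaleC_left cinner_scaleC_right \<beta>_def[symmetric] \<beta>' algebra_simps)
    also have "a * \<beta> = - complex_of_real (s * (cmod \<beta>)\<^sup>2)"
      unfolding of_real_mult complex_norm_square by (simp add: a_def mult_ac)
    also have "a * cnj a = complex_of_real (s\<^sup>2 * (cmod \<beta>)\<^sup>2)"
      unfolding of_real_mult complex_norm_square by (simp add: a_def power2_eq_square mult_ac)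
    finally show ?thesis by (simp add: c_def algebra_simps)
  qed
  have "c \<ge> 0" using positive_op_real[OF assms] c_def by blast
  then show ?thesis unfolding \<beta>_def[symmetric] c_def[symmetric]
  proof (cases "c = 0")
    case True
    have "(cmod \<beta>)\<^sup>2 = 0"
    proof (rule ccontr)
      assume "(cmod \<beta>)\<^sup>2 \<noteq> 0"
      then show False
        using quad[of "(Re (cinner x (Q x)) + 1) / (2 * (cmod \<beta>)\<^sup>2)"] True
        by (simp add: field_simps)
    qed
    then show "(cmod \<beta>)\<^sup>2 \<le> Re (cinner x (Q x)) * c" using True by simp
  next
    case False
    then show "(cmod \<beta>)\<^sup>2 \<le> Re (cinner x (Q x)) * c"
      using quad[of "1 / c"] \<open>c \<ge> 0\<close> by (simp add: field_simps power2_eq_square)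
  qed
qed

lemma bounded_op_id: "bounded_op id"
  by (rule bounded_opI[where K = 1]) simp_all

lemma cmod_cinner_le:
  fixes x y :: "'a::complex_hilbert_space"
  shows "cmod (cinner x y) \<le> norm x * norm y"
proof -
  have "positive_op (id :: 'a \<Rightarrow> 'a)"
    unfolding positive_op_def by (auto intro: bounded_op_id cinner_ge_zero)
  from positive_op_Cauchy_Schwarz[OF this, of x y]
  have "(cmod (cinner x y))\<^sup>2 \<le> (norm x * norm y)\<^sup>2"
    by (simp add: cinner_self power_mult_distrib del: of_real_power)
  then show ?thesis by (rule power2_le_imp_le) simp
qed

lemma bounded_bilinear_cinner: "bounded_bilinear cinner"
  by standard
    (auto simp: cinner_add_left cinner_add_right scaleR_scaleC cinner_scaleC_left
      cinner_scaleC_right scaleR_conv_of_real intro!: exI[of _ 1] cmod_cinner_le)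

lemmas cinner_zero_left = bounded_bilinear.zero_left[OF bounded_bilinear_cinner]
  and cinner_zero_right = bounded_bilinear.zero_right[OF bounded_bilinear_cinner]
  and cinner_diff_left = bounded_bilinear.diff_left[OF bounded_bilinear_cinner]
  and cinner_diff_right = bounded_bilinear.diff_right[OF bounded_bilinear_cinner]
  and cinner_sum_left = bounded_bilinear.sum_left[OF bounded_bilinear_cinner]
  and cinner_sum_right = bounded_bilinear.sum_right[OF bounded_bilinear_cinner]
  and tendsto_cinner = bounded_bilinear.tendsto[OF bounded_bilinear_cinner]

lemma cinner_ext: "(\<And>z. cinner x z = cinner y z) \<Longrightarrow> x = y"
  by (metis cinner_diff_left cinner_eq_zero_iff eq_iff_diff_eq_0)

lemma norm_add_square: "(norm (x + y))\<^sup>2 = (norm x)\<^sup>2 + 2 * Re (cinner x y) + (norm (y :: 'a::complex_hilbert_space))\<^sup>2"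
proof -
  have "(norm z)\<^sup>2 = Re (cinner z z)" for z :: 'a by (simp add: cinner_self del: of_real_power)
  then show ?thesis
    using cinner_commute[of x y] by (simp add: cinner_add_left cinner_add_right)
qed

text \<open>The representing vector of \<open>f\<close> is the minimizer of \<open>\<parallel>x\<parallel>\<^sup>2 - 2 Re f(x)\<close>: the parallelogram
  law makes minimizing sequences Cauchy, and the first variation at the minimizer vanishes.\<close>

lemma Riesz_representation:
  fixes f :: "'a::complex_hilbert_space \<Rightarrow> complex"
  assumes add: "\<And>x y. f (x + y) = f x + f y" and scale: "\<And>a x. f (a *\<^sub>C x) = a * f x"
    and bound: "\<And>x. cmod (f x) \<le> K * norm x"
  shows "\<exists>v. \<forall>x. f x = cinner v x"
proof -
  define J where "J x = (norm x)\<^sup>2 - 2 * Re (f x)" for x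
  have lin: "bounded_linear f"
    by (rule bounded_linear_intro[of f K])
       (use add scale bound in \<open>simp_all add: scaleR_scaleC scaleR_conv_of_real mult.commute\<close>)
  have lower: "J x \<ge> - K\<^sup>2" for x
  proof -
    have "Re (f x) \<le> K * norm x" using complex_Re_le_cmod[of "f x"] bound[of x] by linarith
    moreover have "0 \<le> (norm x - K)\<^sup>2" by simp
    ultimately show ?thesis by (simp add: J_def power2_diff algebra_simps)
  qed
  have bdd: "bdd_below (range J)" using lower by (auto simp: bdd_below_def)
  define m where "m = Inf (range J)"
  have m_le: "m \<le> J x" for x unfolding m_def using bdd by (simp add: cInf_lower)
  have "\<exists>x. J x < m + 1 / real (Suc n)" for n
  proof -
    have "Inf (range J) < m + 1 / real (Suc n)" by (simp add: m_def)
    then show ?thesis using cInf_lessD[of "range J"] by blast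
  qed
  then obtain X where X: "\<And>n. J (X n) < m + 1 / real (Suc n)" by metis
  have par: "(norm (x - y))\<^sup>2 \<le> 2 * (J x - m) + 2 * (J y - m)" for x y
  proof -
    define w where "w = complex_of_real (1/2) *\<^sub>C (x + y)"
    have "(norm (x - y))\<^sup>2 + (norm (x + y))\<^sup>2 = 2 * (norm x)\<^sup>2 + 2 * (norm y)\<^sup>2"
      using norm_add_square[of x y] norm_add_square[of x "- y"]
      by (simp add: bounded_bilinear.minus_right[OF bounded_bilinear_cinner])
    moreover have "(norm w)\<^sup>2 = (norm (x + y))\<^sup>2 / 4"
      unfolding w_def norm_scaleC by (simp add: power2_eq_square)
    moreover have "Re (f w) = (Re (f x) + Re (f y)) / 2"
      unfolding w_def by (simp only: scale add) simp
    ultimately show ?thesis using m_le[of w] by (simp add: J_def)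
  qed
  have "Cauchy X"
  proof (rule metric_CauchyI)
    fix e :: real assume "e > 0"
    then obtain N where N: "1 / real (Suc N) < e\<^sup>2 / 4"
      using nat_approx_posE[of "e\<^sup>2 / 4"] by auto
    have "dist (X i) (X j) < e" if "i \<ge> N" "j \<ge> N" for i j
    proof -
      have "J (X k) - m < e\<^sup>2 / 4" if "k \<ge> N" for k
        using X[of k] N that frac_le[of 1 1 "real (Suc N)" "real (Suc k)"] by simp
      from this[OF that(1)] this[OF that(2)] have "2 * (J (X i) - m) + 2 * (J (X j) - m) < e\<^sup>2"
        by (simp add: field_simps)
      with par[of "X i" "X j"] have "(norm (X i - X j))\<^sup>2 < e\<^sup>2" by linarith
      then show ?thesis using \<open>e > 0\<close> by (simp add: dist_norm power_less_imp_less_base)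
    qed
    then show "\<exists>M. \<forall>m\<ge>M. \<forall>n\<ge>M. dist (X m) (X n) < e" by blast
  qed
  then obtain v where v: "X \<longlonglongrightarrow> v" using Cauchy_convergent convergent_def by blast
  have "(\<lambda>n. J (X n)) \<longlonglongrightarrow> J v"
    unfolding J_def by (intro tendsto_intros v bounded_linear.tendsto[OF lin])
  moreover have "(\<lambda>n. m + 1 / real (Suc n)) \<longlonglongrightarrow> m"
    using tendsto_add[OF tendsto_const[of m] LIMSEQ_inverse_real_of_nat] by (simp add: inverse_eq_divide)
  ultimately have "J v \<le> m" using X by (meson LIMSEQ_le less_imp_le)
  then have min: "J v \<le> J x" for x using m_le[of x] by linarith
  have re: "Re (f h) = Re (cinner v h)" for h
  proof -
    define d where "d = Re (cinner v h) - Re (f h)"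
    define q where "q = (norm h)\<^sup>2"
    have "q \<ge> 0" by (simp add: q_def)
    have pos: "0 \<le> 2 * s * d + s\<^sup>2 * q" for s
      using min[of "v + complex_of_real s *\<^sub>C h"]
      by (simp add: J_def norm_add_square add scale norm_scaleC cinner_scaleC_right d_def q_def
          power_mult_distrib algebra_simps)
    define s where "s = - d / (q + 1)"
    have d: "d = - s - s * q" 
    proof -
      have "s * (q + 1) = - d" using \<open>q \<ge> 0\<close> by (simp add: s_def)
      then show ?thesis by (simp add: algebra_simps)
    qed
    have "0 \<le> s * (2 * d + s * q)" using pos[of s] by (simp add: power2_eq_square algebra_simps)
    also have "\<dots> = - s\<^sup>2 * (q + 2)" unfolding d
      by (simp add: power2_eq_square algebra_simps)
    finally have "s = 0" using \<open>q \<ge> 0\<close> by (simp add: mult_le_0_iff)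
    then have "d = 0" using d by simp
    then show ?thesis by (simp add: d_def)
  qed
  have "f h = cinner v h" for h
    using re[of h] re[of "\<i> *\<^sub>C h"] by (simp add: scale cinner_scaleC_right complex_eq_iff)
  then show ?thesis by blast
qed

lemma adj_eqI:
  assumes "\<And>x y. cinner (S x) y = cinner x (T y)"
  shows "adj T = S"
  unfolding adj_def
proof (rule the_equality)
  fix S' assume "\<forall>x y. cinner (S' x) y = cinner x (T y)"
  then show "S' = S" using assms by (metis cinner_ext ext)
qed (use assms in blast)

lemma cinner_adj:
  assumes "bounded_op T"
  shows "cinner (adj T x) y = cinner x (T y)"
proof -
  obtain K where K: "0 \<le> K" "\<And>x. norm (T x) \<le> K * norm x" using bounded_op_bound[OF assms] by blast
  have "\<exists>v. \<forall>y. cinner x (T y) = cinner v y" for x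
  proof (rule Riesz_representation)
    show "cmod (cinner x (T y)) \<le> (norm x * K) * norm y" for y
      using cmod_cinner_le[of x "T y"] mult_left_mono[OF K(2)[of y], of "norm x"]
      by (simp add: mult.assoc)
  qed (simp_all add: bounded_op_add[OF assms] bounded_op_scaleC[OF assms] cinner_add_right
      cinner_scaleC_right)
  then obtain S where "\<And>x y. cinner x (T y) = cinner (S x) y" by metis
  then have S: "cinner (S x) y = cinner x (T y)" for x y by simp
  then show ?thesis using adj_eqI[of S T] by simp
qed

lemma bounded_op_compose:
  assumes "bounded_op S" "bounded_op T"
  shows "bounded_op (S \<circ> T)"
proof -
  obtain K L where K: "K \<ge> 0" "\<And>x. norm (S x) \<le> K * norm x" and L: "\<And>x. norm (T x) \<le> L * norm x"
    using assms[THEN bounded_op_bound] by blast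
  show ?thesis
  proof (rule bounded_opI[where K = "K * L"])
    show "norm ((S \<circ> T) x) \<le> K * L * norm x" for x
      using K(2)[of "T x"] mult_left_mono[OF L[of x] K(1)] by (simp add: mult.assoc)
  qed (simp_all add: assms bounded_op_add bounded_op_scaleC)
qed

lemma bounded_op_adj:
  assumes "bounded_op T"
  shows "bounded_op (adj T)"
proof -
  obtain K where K: "K \<ge> 0" "\<And>x. norm (T x) \<le> K * norm x"
    using bounded_op_bound[OF assms] by blast
  show ?thesis
  proof (rule bounded_opI[where K = K])
    show "norm (adj T x) \<le> K * norm x" for x
    proof (cases "adj T x = 0")
      case False
      have "(norm (adj T x))\<^sup>2 = cmod (cinner (adj T x) (adj T x))"
        by (simp add: cinner_self del: of_real_power)
      also have "\<dots> = cmod (cinner x (T (adj T x)))" by (simp add: cinner_adj[OF assms])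
      also have "\<dots> \<le> norm x * norm (T (adj T x))" by (rule cmod_cinner_le)
      also have "\<dots> \<le> norm x * (K * norm (adj T x))" by (intro mult_left_mono K) simp
      finally show ?thesis using False by (simp add: power2_eq_square mult_ac)
    qed (use K(1) in simp)
  qed (rule cinner_ext; simp add: cinner_adj[OF assms] cinner_add_left cinner_scaleC_left)+
qed

lemma cinner_adj_right: "bounded_op T \<Longrightarrow> cinner x (adj T y) = cinner (T x) y"
  by (metis cinner_adj cinner_commute)

section \<open>Unitary operators\<close>

lemma unitary_opI:
  assumes add: "\<And>x y. U (x + y) = U x + U y" and scale: "\<And>a x. U (a *\<^sub>C x) = a *\<^sub>C U x"
    and isometric: "\<And>x y. cinner (U x) (U y) = cinner x y" and "surj U"
  shows "unitary_op U"
proof -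
  have norm: "norm (U x) = norm x" for x
    by (simp add: norm_eq_sqrt_cinner isometric)
  have "inj U"
    by (metis (no_types) cinner_ext injI isometric)
  have "cinner (inv U x) y = cinner x (U y)" for x y
    using isometric[of "inv U x" y] surj_f_inv_f[OF \<open>surj U\<close>] by simp
  then have "adj U = inv U" by (rule adj_eqI)
  moreover have "bounded_op U" by (rule bounded_opI[where K = 1]) (simp_all add: add scale norm)
  ultimately show ?thesis
    using \<open>inj U\<close> \<open>surj U\<close> unfolding unitary_op_def by (simp add: fun_eq_iff surj_f_inv_f)
qed

lemma unitary_op_bounded: "unitary_op U \<Longrightarrow> bounded_op U"
  by (simp add: unitary_op_def)

lemma unitary_op_cinner: "unitary_op U \<Longrightarrow> cinner (U x) (U y) = cinner x y"
  unfolding unitary_op_def by (metis cinner_adj comp_apply id_apply)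

lemma unitary_op_norm: "unitary_op U \<Longrightarrow> norm (U x) = norm x"
  by (simp add: norm_eq_sqrt_cinner unitary_op_cinner)

lemma unitary_op_adj_apply:
  assumes "unitary_op U" shows "U (adj U x) = x" "adj U (U x) = x"
  using assms unfolding unitary_op_def fun_eq_iff by simp_all

lemma unitary_op_compose:
  assumes "unitary_op U" "unitary_op V"
  shows "unitary_op (U \<circ> V)"
proof (rule unitary_opI)
  show "surj (U \<circ> V)"
    using assms[THEN unitary_op_adj_apply(1)] by (metis comp_apply surj_def)
qed (simp_all add: assms[THEN unitary_op_bounded] bounded_op_add bounded_op_scaleC
    unitary_op_cinner assms)

lemma adj_compose:
  assumes "bounded_op S" "bounded_op T"
  shows "adj (S \<circ> T) = adj T \<circ> adj S"
  by (rule adj_eqI) (simp add: assms cinner_adj)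

section \<open>Orthonormal bases\<close>

definition orthonormal_basis_sequence :: "(nat \<Rightarrow> 'a::complex_hilbert_space) \<Rightarrow> bool" where
  "orthonormal_basis_sequence b \<longleftrightarrow>
     orthonormal_sequence b \<and> closure (complex_vector.span (range b)) = UNIV"

lemma orthonormal_sequence_cinner:
  "orthonormal_sequence b \<Longrightarrow> cinner (b i) (b j) = (if i = j then 1 else 0)"
  by (simp add: orthonormal_sequence_def)

text \<open>The Pythagorean theorem for the remainder of a partial Fourier expansion; it yields both
  Bessel's inequality and a uniform bound on the remainders.\<close>

lemma orthonormal_remainder:
  assumes "orthonormal_sequence b"
  shows "(norm (x - (\<Sum>n<N. cinner (b n) x *\<^sub>C b n)))\<^sup>2
    = (norm x)\<^sup>2 - (\<Sum>n<N. (cmod (cinner (b n) x))\<^sup>2)"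
proof -
  let ?s = "\<Sum>n<N. cinner (b n) x *\<^sub>C b n"
  have bs: "cinner (b i) ?s = (if i < N then cinner (b i) x else 0)" for i
    by (simp add: cinner_sum_right cinner_scaleC_right orthonormal_sequence_cinner[OF assms]
        if_distrib[of "\<lambda>c. _ * c"] cong: if_cong)
  have *: "cinner ?s y = (\<Sum>n<N. cnj (cinner (b n) x) * cinner (b n) y)" for y
    by (simp add: cinner_sum_left cinner_scaleC_left)
  have sq: "cnj z * z = complex_of_real ((cmod z)\<^sup>2)" for z
    by (subst complex_norm_square) (rule mult.commute)
  have sx: "cinner ?s x = complex_of_real (\<Sum>n<N. (cmod (cinner (b n) x))\<^sup>2)"
    unfolding * sq by simp
  have ss: "cinner ?s ?s = cinner ?s x"
    unfolding *[of ?s] *[of x] by (rule sum.cong) (simp_all add: bs)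
  have xs: "cinner x ?s = cinner ?s x" using sx by (subst cinner_commute) simp
  have "complex_of_real ((norm (x - ?s))\<^sup>2) = cinner x x - cinner ?s x"
    unfolding cinner_self[symmetric] by (simp add: cinner_diff_left cinner_diff_right ss xs)
  also have "\<dots> = complex_of_real ((norm x)\<^sup>2 - (\<Sum>n<N. (cmod (cinner (b n) x))\<^sup>2))"
    unfolding cinner_self sx by simp
  finally show ?thesis using of_real_eq_iff by blast
qed

lemma Bessel_inequality:
  assumes "orthonormal_sequence b"
  shows "(\<Sum>n<N. (cmod (cinner (b n) x))\<^sup>2) \<le> (norm x)\<^sup>2"
  using orthonormal_remainder[OF assms, of x N] zero_le_power2[of "norm (x - (\<Sum>n<N. cinner (b n) x *\<^sub>C b n))"]
  by linarith

lemma orthonormal_sequence_weakly_null: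
  assumes "orthonormal_sequence f"
  shows "(\<lambda>n. cinner x (f n)) \<longlonglongrightarrow> 0"
proof -
  have "summable (\<lambda>n. (cmod (cinner (f n) x))\<^sup>2)"
    by (rule bounded_imp_summable[where B = "(norm x)\<^sup>2"])
       (use Bessel_inequality[OF assms, of x "Suc _"] in \<open>simp_all add: lessThan_Suc_atMost\<close>)
  then have "(\<lambda>n. (cmod (cinner (f n) x))\<^sup>2) \<longlonglongrightarrow> 0" by (rule summable_LIMSEQ_zero)
  then have "(\<lambda>n. sqrt ((cmod (cinner (f n) x))\<^sup>2)) \<longlonglongrightarrow> sqrt 0" by (rule tendsto_real_sqrt)
  then have "(\<lambda>n. cnj (cinner (f n) x)) \<longlonglongrightarrow> 0"
    using tendsto_norm_zero_cancel[of "\<lambda>n. cnj (cinner (f n) x)"] by simp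
  then show ?thesis
    by (simp add: cinner_commute[of x])
qed

text \<open>A density argument: the set where a uniformly bounded sequence of seminorms
  tends to zero is a closed subspace, so it is enough to look at a basis.\<close>

lemma seminorms_tendsto_zero:
  fixes p :: "nat \<Rightarrow> 'a::complex_hilbert_space \<Rightarrow> real"
  assumes b: "orthonormal_basis_sequence b"
    and nonneg: "\<And>n x. 0 \<le> p n x" and triangle: "\<And>n x y. p n (x + y) \<le> p n x + p n y"
    and scale: "\<And>n a x. p n (a *\<^sub>C x) = cmod a * p n x"
    and bound: "\<And>n x. p n x \<le> M * norm x"
    and basis: "\<And>j. (\<lambda>n. p n (b j)) \<longlonglongrightarrow> 0"
  shows "(\<lambda>n. p n x) \<longlonglongrightarrow> 0"
proof -
  let ?S = "{x. (\<lambda>n. p n x) \<longlonglongrightarrow> 0}"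
  have "complex_vector.subspace ?S"
  proof (rule complex_vector.subspaceI)
    have "p n 0 = 0" for n using scale[of n 0 0] by simp
    then show "0 \<in> ?S" by simp
  next
    fix x y assume "x \<in> ?S" "y \<in> ?S"
    then have "(\<lambda>n. p n x + p n y) \<longlonglongrightarrow> 0" using tendsto_add[of "\<lambda>n. p n x" 0 sequentially "\<lambda>n. p n y" 0] by simp
    then have "(\<lambda>n. p n (x + y)) \<longlonglongrightarrow> 0"
      by (rule tendsto_sandwich[OF _ _ tendsto_const, rotated 2]) (auto simp: nonneg triangle)
    then show "x + y \<in> ?S" by simp
  qed (auto simp: scale intro: tendsto_mult_right_zero)
  then have span: "complex_vector.span (range b) \<subseteq> ?S"
    using basis by (intro complex_vector.span_minimal) auto
  show ?thesis
  proof (rule LIMSEQ_I)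
    fix e :: real assume "e > 0"
    define \<delta> where "\<delta> = e / (2 * (\<bar>M\<bar> + 1))"
    have "\<delta> > 0" using \<open>e > 0\<close> by (simp add: \<delta>_def)
    moreover have "x \<in> closure (complex_vector.span (range b))"
      using b by (simp add: orthonormal_basis_sequence_def)
    ultimately obtain y where y: "y \<in> complex_vector.span (range b)" "dist y x < \<delta>"
      by (meson closure_approachable)
    have "\<bar>M\<bar> * norm (x - y) \<le> \<bar>M\<bar> * \<delta>"
      using y(2) by (intro mult_left_mono) (simp_all add: dist_norm norm_minus_commute)
    also have "\<dots> \<le> e / 2" using \<open>e > 0\<close> by (simp add: \<delta>_def field_simps)
    finally have close: "\<bar>M\<bar> * norm (x - y) \<le> e / 2" .
    have "(\<lambda>n. p n y) \<longlonglongrightarrow> 0" using span y(1) by blast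
    then obtain N where N: "\<And>n. n \<ge> N \<Longrightarrow> norm (p n y - 0) < e / 2"
      using LIMSEQ_D[of "\<lambda>n. p n y" 0 "e / 2"] \<open>e > 0\<close> by auto
    have "norm (p n x - 0) < e" if "n \<ge> N" for n
    proof -
      have "p n x \<le> p n (x - y) + p n y" using triangle[of n "x - y" y] by simp
      also have "p n (x - y) \<le> \<bar>M\<bar> * norm (x - y)"
        using bound[of n "x - y"] mult_right_mono[OF abs_ge_self[of M], of "norm (x - y)"] by simp
      finally show ?thesis using N[OF that] close nonneg[of n x] nonneg[of n y] by simp
    qed
    then show "\<exists>N. \<forall>n\<ge>N. norm (p n x - 0) < e" by blast
  qed
qed

lemma orthonormal_expansion:
  assumes "orthonormal_basis_sequence b"
  shows "(\<lambda>n. cinner (b n) x *\<^sub>C b n) sums x"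
proof -
  have b: "orthonormal_sequence b" using assms by (simp add: orthonormal_basis_sequence_def)
  define R where "R N x = x - (\<Sum>n<N. cinner (b n) x *\<^sub>C b n)" for N x
  have "(\<lambda>N. norm (R N x)) \<longlonglongrightarrow> 0"
  proof (rule seminorms_tendsto_zero[OF assms, where M = 1])
    have "R N (x + y) = R N x + R N y" for N x y
      by (simp add: R_def cinner_add_right scaleC_add_left sum.distrib)
    then show "norm (R N (x + y)) \<le> norm (R N x) + norm (R N y)" for N x y
      by (simp add: norm_triangle_ineq)
    have "R N (a *\<^sub>C x) = a *\<^sub>C R N x" for N a x
      by (simp add: R_def cinner_scaleC_right scaleC_scaleC complex_vector.scale_right_diff_distrib
          complex_vector.scale_sum_right)
    then show "norm (R N (a *\<^sub>C x)) = cmod a * norm (R N x)" for N a x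
      by (simp add: norm_scaleC)
    show "norm (R N x) \<le> 1 * norm x" for N x
    proof (rule power2_le_imp_le)
      show "(norm (R N x))\<^sup>2 \<le> (1 * norm x)\<^sup>2"
        unfolding R_def orthonormal_remainder[OF b] by (simp add: sum_nonneg)
    qed simp
    have "R N (b j) = 0" if "N > j" for N j
      using that by (simp add: R_def orthonormal_sequence_cinner[OF b] scaleC_one
          if_distrib[of "\<lambda>c. c *\<^sub>C _"] cong: if_cong)
    then show "(\<lambda>N. norm (R N (b j))) \<longlonglongrightarrow> 0" for j
      by (intro tendsto_eventually eventually_sequentiallyI[of "Suc j"]) simp
  qed simp
  then have "(\<lambda>N. x - R N x) \<longlonglongrightarrow> x - 0"
    by (intro tendsto_diff tendsto_const) (rule tendsto_norm_zero_cancel)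
  then show ?thesis by (simp add: sums_def R_def)
qed

lemma Parseval:
  assumes "orthonormal_basis_sequence b"
  shows "(\<lambda>n. cinner x (b n) * cinner (b n) y) sums cinner x y"
  using bounded_linear.sums[OF bounded_bilinear.bounded_linear_right[OF bounded_bilinear_cinner]
      orthonormal_expansion[OF assms, of y], of x]
  by (simp add: cinner_scaleC_right mult.commute)

lemma Parseval_norm:
  assumes "orthonormal_basis_sequence b"
  shows "(\<lambda>n. (cmod (cinner (b n) x))\<^sup>2) sums (norm x)\<^sup>2"
proof -
  have "cinner x (b n) * cinner (b n) x = complex_of_real ((cmod (cinner (b n) x))\<^sup>2)" for n
    by (subst cinner_commute, subst complex_norm_square) (rule mult.commute)
  then show ?thesis
    using Parseval[OF assms, of x x] by (simp add: cinner_self sums_of_real_iff del: of_real_power)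
qed

text \<open>A bound by the inequality between arithmetic and geometric means; the constant is immaterial.\<close>

lemma Parseval_absolute:
  assumes "orthonormal_basis_sequence b"
  shows "summable (\<lambda>n. norm (cinner x (b n) * cinner (b n) y))"
    and "(\<Sum>n. norm (cinner x (b n) * cinner (b n) y)) \<le> (norm x)\<^sup>2 + (norm y)\<^sup>2"
proof -
  have le: "norm (cinner x (b n) * cinner (b n) y)
      \<le> (cmod (cinner (b n) x))\<^sup>2 + (cmod (cinner (b n) y))\<^sup>2" for n
  proof -
    have eq: "cmod (cinner x (b n)) = cmod (cinner (b n) x)"
      by (subst cinner_commute) simp
    define u v where "u = cmod (cinner (b n) x)" and "v = cmod (cinner (b n) y)"
    have "0 \<le> (u - v)\<^sup>2 + u * v" by (simp add: u_def v_def)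
    then have "u * v \<le> u\<^sup>2 + v\<^sup>2" by (simp add: u_def v_def power2_eq_square algebra_simps)
    then show ?thesis by (simp add: norm_mult eq u_def v_def)
  qed
  have sums: "(\<lambda>n. (cmod (cinner (b n) x))\<^sup>2 + (cmod (cinner (b n) y))\<^sup>2) sums ((norm x)\<^sup>2 + (norm y)\<^sup>2)"
    by (intro sums_add Parseval_norm assms)
  show summ: "summable (\<lambda>n. norm (cinner x (b n) * cinner (b n) y))"
    by (rule summable_comparison_test'[OF sums_summable[OF sums], of 0]) (use le in simp)
  show "(\<Sum>n. norm (cinner x (b n) * cinner (b n) y)) \<le> (norm x)\<^sup>2 + (norm y)\<^sup>2"
    using suminf_le[OF le summ sums_summable[OF sums]] sums_unique[OF sums] by simp
qed

lemma orthonormal_basis_enumeration: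
  fixes B :: "'a::complex_hilbert_space set"
  assumes infinite_dim: "cinfinite_dimensional TYPE('a)"
    and separable: "separable_space (euclidean :: 'a topology)"
    and B: "orthonormal_basis B"
  obtains b where "orthonormal_basis_sequence b" "bij_betw b UNIV B"
proof -
  have ortho: "cinner x y = (if x = y then 1 else 0)" if "x \<in> B" "y \<in> B" for x y
    using B that by (simp add: orthonormal_basis_def orthonormal_set_def)
  \<comment> \<open>Distinct elements of \<open>B\<close> are at distance \<open>\<surd>2\<close>, so points of a dense set within \<open>1/2\<close> of them are distinct.\<close>
  have "countable B"
  proof -
    obtain D :: "'a set" where D: "countable D" "closure D = UNIV"
      using separable by (auto simp: separable_space_def)
    have "\<exists>d\<in>D. dist d x < 1 / 2" for x
      using closure_approachable[of x D] D(2) half_gt_zero[OF zero_less_one] by blast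
    then obtain d where d: "\<And>x. d x \<in> D" "\<And>x. dist (d x) x < 1 / 2" by metis
    have "inj_on d B"
    proof (rule inj_onI, rule ccontr)
      fix x y assume xy: "x \<in> B" "y \<in> B" "d x = d y" "x \<noteq> y"
      have "norm x = 1" "norm y = 1" using ortho xy(1,2) by (simp_all add: norm_eq_sqrt_cinner)
      then have "(dist x y)\<^sup>2 = 2"
        using norm_add_square[of x "- y"] ortho[OF xy(1,2)] xy(4)
        by (simp add: dist_norm bounded_bilinear.minus_right[OF bounded_bilinear_cinner])
      moreover have "dist x y < 1"
        using dist_triangle[of x y "d x"] d(2)[of x] d(2)[of y] xy(3)
        by (simp add: dist_commute)
      then have "(dist x y)\<^sup>2 < 1" by (simp add: power_less_one_iff abs_square_less_1)
      ultimately show False by simp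
    qed
    then show ?thesis
      using D(1) d(1) by (meson countable_image_inj_on countable_subset image_subsetI)
  qed
  \<comment> \<open>For finite \<open>B\<close> the remainder of the Fourier expansion is orthogonal to the dense span of \<open>B\<close>.\<close>
  moreover have "infinite B"
  proof
    assume fin: "finite B"
    have "x \<in> complex_vector.span B" for x
    proof -
      define s where "s = (\<Sum>e\<in>B. cinner e x *\<^sub>C e)"
      have s: "s \<in> complex_vector.span B"
        unfolding s_def by (intro complex_vector.span_sum complex_vector.span_scale complex_vector.span_base)
      have "cinner e s = cinner e x" if "e \<in> B" for e
      proof -
        have "cinner e s = (\<Sum>e'\<in>B. cinner e' x * (if e = e' then 1 else 0))"
          unfolding s_def cinner_sum_right cinner_scaleC_right
          by (rule sum.cong) (use ortho that in auto)
        also have "\<dots> = cinner e x"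
          using fin that by (simp add: if_distrib[of "\<lambda>c. _ * c"] cong: if_cong)
        finally show ?thesis .
      qed
      then have base: "B \<subseteq> {y. cinner y (x - s) = 0}" by (auto simp: cinner_diff_right)
      have "complex_vector.subspace {y. cinner y (x - s) = 0}"
        by (rule complex_vector.subspaceI)
           (simp_all add: cinner_zero_left cinner_add_left cinner_scaleC_left)
      then have "complex_vector.span B \<subseteq> {y. cinner y (x - s) = 0}"
        using base by (intro complex_vector.span_minimal)
      moreover have "closed {y. cinner y (x - s) = 0}"
        by (intro closed_Collect_eq continuous_on_const linear_continuous_on
            bounded_bilinear.bounded_linear_left[OF bounded_bilinear_cinner])
      ultimately have "closure (complex_vector.span B) \<subseteq> {y. cinner y (x - s) = 0}"
        by (rule closure_minimal)
      then have "cinner (x - s) (x - s) = 0" using B by (auto simp: orthonormal_basis_def)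
      then show ?thesis using s by (simp add: cinner_eq_zero_iff)
    qed
    then show False using infinite_dim fin unfolding cinfinite_dimensional_def by blast
  qed
  ultimately obtain b where b: "bij_betw b (UNIV :: nat set) B"
    using bij_betw_from_nat_into by blast
  have "orthonormal_sequence b"
    unfolding orthonormal_sequence_def
    using b ortho by (auto simp: bij_betw_def inj_eq)
  moreover have "range b = B" using b by (simp add: bij_betw_def)
  ultimately have "orthonormal_basis_sequence b"
    using B by (simp add: orthonormal_basis_sequence_def orthonormal_basis_def)
  then show thesis using b that by blast
qed

section \<open>Trace-class operators\<close>

text \<open>One step of the Cholesky decomposition of a positive operator: subtracting the rank-one
  operator that agrees with \<open>Q\<close> on \<open>v\<close> preserves positivity, by Cauchy--Schwarz for the form
  of \<open>Q\<close>, and preserves the kernel. If \<open>\<langle>v, Qv\<rangle> = 0\<close> then \<open>Qv = 0\<close> already, and the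
  value \<open>0\<close> of the quotient is the right one.\<close>

lemma positive_op_Schur_complement:
  fixes Q :: "'a::complex_hilbert_space \<Rightarrow> 'a" and v :: 'a
  assumes "positive_op Q"
  defines "R \<equiv> \<lambda>x. Q x - (cinner (Q v) x / cinner v (Q v)) *\<^sub>C Q v"
  shows "positive_op R" "R v = 0" "Q w = 0 \<Longrightarrow> R w = 0"
    and "Re (cinner x (R x)) = Re (cinner x (Q x)) - (cmod (cinner (Q v) x))\<^sup>2 / Re (cinner v (Q v))"
proof -
  have Q: "bounded_op Q" using assms by (simp add: positive_op_def)
  define d where "d = Re (cinner v (Q v))"
  have d: "cinner v (Q v) = complex_of_real d" "d \<ge> 0"
    using positive_op_real[OF assms(1), of v] by (simp_all add: d_def complex_eq_iff)
  have xR: "cinner x (R x) = complex_of_real (Re (cinner x (Q x)) - (cmod (cinner (Q v) x))\<^sup>2 / d)" for x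
  proof -
    have "cinner x (R x) = cinner x (Q x) - cinner (Q v) x * cnj (cinner (Q v) x) / d"
      unfolding R_def d cinner_diff_right cinner_scaleC_right
      by (simp add: cinner_commute[of x "Q v"])
    moreover have "cinner x (Q x) = complex_of_real (Re (cinner x (Q x)))"
      using positive_op_real[OF assms(1), of x] by (simp add: complex_eq_iff)
    ultimately show ?thesis
      by (metis complex_norm_square of_real_diff of_real_divide)
  qed
  then show "Re (cinner x (R x)) = Re (cinner x (Q x)) - (cmod (cinner (Q v) x))\<^sup>2 / Re (cinner v (Q v))"
    by (simp add: d_def)
  have bounded: "bounded_op R"
  proof -
    obtain K where K: "K \<ge> 0" "\<And>x. norm (Q x) \<le> K * norm x"
      using bounded_op_bound[OF Q] by blast
    show ?thesis
    proof (rule bounded_opI[where K = "K + norm (Q v) * norm (Q v) / d"])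
      show "norm (R x) \<le> (K + norm (Q v) * norm (Q v) / d) * norm x" for x
      proof -
        have "norm (R x) \<le> norm (Q x) + cmod (cinner (Q v) x) / d * norm (Q v)"
          unfolding R_def d using norm_triangle_ineq4[of "Q x"] d(2)
          by (metis abs_of_nonneg norm_divide norm_of_real norm_scaleC)
        also have "\<dots> \<le> K * norm x + norm (Q v) * norm x / d * norm (Q v)"
          by (intro add_mono mult_right_mono divide_right_mono K cmod_cinner_le d norm_ge_zero)
        finally show ?thesis by (simp add: algebra_simps)
      qed
    qed (simp_all add: R_def bounded_op_add[OF Q] bounded_op_scaleC[OF Q] cinner_add_right
        cinner_scaleC_right add_divide_distrib scaleC_add_left complex_vector.scale_right_diff_distrib
        scaleC_scaleC)
  qed
  have pos: "0 \<le> Re (cinner x (Q x)) - (cmod (cinner (Q v) x))\<^sup>2 / d" for x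
  proof (cases "d = 0")
    case True
    then show ?thesis using positive_op_real[OF assms(1), of x] by simp
  next
    case False
    have "(cmod (cinner (Q v) x))\<^sup>2 \<le> d * Re (cinner x (Q x))"
      unfolding positive_op_hermitian[OF assms(1)] d_def
      by (rule positive_op_Cauchy_Schwarz[OF assms(1)])
    then show ?thesis using False d(2) by (simp add: field_simps)
  qed
  show "positive_op R"
    unfolding positive_op_def using bounded pos by (simp add: xR complex_nonneg_Reals_iff)
  show "R v = 0"
  proof (cases "d = 0")
    case True
    have "(cmod (cinner (Q v) (Q v)))\<^sup>2 \<le> Re (cinner (Q v) (Q (Q v))) * d"
      unfolding d_def by (rule positive_op_Cauchy_Schwarz[OF assms(1)])
    then have "Q v = 0" using True by (simp add: cinner_eq_zero_iff)
    then show ?thesis by (simp add: R_def)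
  next
    case False
    then show ?thesis
      by (simp add: R_def positive_op_hermitian[OF assms(1)] d scaleC_one)
  qed
  show "R w = 0" if "Q w = 0"
    using that by (simp add: R_def positive_op_hermitian[OF assms(1)] cinner_zero_right)
qed

text \<open>After \<open>k\<close> elimination steps along \<open>b\<close> the remainder of \<open>P\<close> is \<open>P \<circ> L\<close> with the \<open>L\<close>
  below. Recording \<open>L\<close> instead of the remainder lets the same elimination be applied to any other
  operator in place of \<open>P\<close>.\<close>

primrec Cholesky_remainder ::
    "('a::complex_hilbert_space \<Rightarrow> 'a) \<Rightarrow> (nat \<Rightarrow> 'a) \<Rightarrow> nat \<Rightarrow> 'a \<Rightarrow> 'a" where
  "Cholesky_remainder P b 0 = (\<lambda>x. x)"
| "Cholesky_remainder P b (Suc k) = (let L = Cholesky_remainder P b k; v = b k in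
     (\<lambda>x. L x - (cinner (P (L v)) x / cinner v (P (L v))) *\<^sub>C L v))"

text \<open>A trace-class operator \<open>C\<close> is a sum of rank-one operators \<open>|s\<^sub>k\<rangle>\<langle>r\<^sub>k|\<close> with
  \<open>\<Sum>\<^sub>k \<parallel>r\<^sub>k\<parallel> \<parallel>s\<^sub>k\<parallel> < \<infinity>\<close>. Running the Cholesky elimination on \<open>P = |C|\<close> along a basis gives
  \<open>P = \<Sum>\<^sub>k |r\<^sub>k\<rangle>\<langle>r\<^sub>k|\<close>, where \<open>\<Sum>\<^sub>k \<parallel>r\<^sub>k\<parallel>\<^sup>2\<close> is bounded by the trace of \<open>P\<close>. Each \<open>r\<^sub>k\<close> is \<open>P u\<^sub>k\<close>
  for an explicit \<open>u\<^sub>k\<close>; put \<open>s\<^sub>k = C u\<^sub>k\<close>. As \<open>\<parallel>Cx\<parallel> = \<parallel>Px\<parallel>\<close>, the remainders of \<open>C\<close>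
  have the same norms as those of \<open>P\<close>, which vanish on ever more basis vectors.\<close>

lemma nuclear_decomposition:
  assumes b: "orthonormal_basis_sequence b" and C: "bounded_op C" and P: "positive_op P"
    and norm_eq: "\<And>x. norm (C x) = norm (P x)"
    and summable: "summable (\<lambda>n. Re (cinner (b n) (P (b n))))"
  obtains r s where "\<And>k. norm (s k) = norm (r k)" "summable (\<lambda>k. (norm (r k))\<^sup>2)"
    "\<And>x. (\<lambda>k. cinner (r k) x *\<^sub>C s k) sums C x"
proof -
  have P': "bounded_op P" using P by (simp add: positive_op_def)
  define L where "L = Cholesky_remainder P b"
  define Q where "Q k x = P (L k x)" for k x
  define d where "d k = Re (cinner (b k) (Q k (b k)))" for k
  have L_Suc: "L (Suc k) x = L k x - (cinner (Q k (b k)) x / cinner (b k) (Q k (b k))) *\<^sub>C L k (b k)" for k x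
    by (simp add: L_def Q_def Let_def)
  have P_diff: "P (x - y) = P x - P y" and C_diff: "C (x - y) = C x - C y" for x y
    using P' C by (auto dest!: bounded_op_linear simp: bounded_linear.linear linear_diff)
  have Q_Suc: "Q (Suc k) x = Q k x - (cinner (Q k (b k)) x / cinner (b k) (Q k (b k))) *\<^sub>C Q k (b k)" for k x
    unfolding Q_def[of "Suc k"] L_Suc P_diff bounded_op_scaleC[OF P'] by (simp add: Q_def)
  have Q_pos: "positive_op (Q k)" for k
  proof (induction k)
    case 0
    then show ?case using P by (simp add: Q_def[abs_def] L_def)
  next
    case (Suc k)
    from positive_op_Schur_complement(1)[OF this, of "b k"] show ?case by (simp add: Q_Suc[abs_def])
  qed
  have d: "cinner (b k) (Q k (b k)) = complex_of_real (d k)" "d k \<ge> 0" for k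
    using positive_op_real[OF Q_pos, of "b k" k] by (simp_all add: d_def complex_eq_iff)
  have Q_zero: "Q N (b j) = 0" if "j < N" for N j
    using that
  proof (induction N)
    case (Suc N)
    show ?case
    proof (cases "j = N")
      case True
      then show ?thesis
        unfolding Q_Suc using positive_op_Schur_complement(2)[OF Q_pos, of N "b N"] by simp
    next
      case False
      then have "Q N (b j) = 0" using Suc by simp
      then show ?thesis
        unfolding Q_Suc using positive_op_Schur_complement(3)[OF Q_pos, of N "b j" "b N"] by simp
    qed
  qed simp
  define r where "r k = complex_of_real (1 / sqrt (d k)) *\<^sub>C Q k (b k)" for k
  define s where "s k = complex_of_real (1 / sqrt (d k)) *\<^sub>C C (L k (b k))" for k
  have norm_rs: "norm (s k) = norm (r k)" for k
    by (simp add: r_def s_def norm_scaleC norm_eq Q_def)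
  have form: "Re (cinner x (Q N x)) = Re (cinner x (P x)) - (\<Sum>k<N. (cmod (cinner (r k) x))\<^sup>2)" for N x
  proof (induction N)
    case 0
    then show ?case by (simp add: Q_def L_def)
  next
    case (Suc N)
    have "(cmod (cinner (Q N (b N)) x))\<^sup>2 / d N = (cmod (cinner (r N) x))\<^sup>2"
      using d(2)[of N] by (simp add: r_def cinner_scaleC_left norm_mult norm_divide power_divide)
    then show ?case
      unfolding Q_Suc positive_op_Schur_complement(4)[OF Q_pos] using Suc by (simp add: d_def)
  qed
  have r_le: "(\<Sum>k<N. (cmod (cinner (r k) x))\<^sup>2) \<le> Re (cinner x (P x))" for N x
    using form[of x N] positive_op_real(2)[OF Q_pos, of x N] by linarith
  have r_summable: "summable (\<lambda>k. (norm (r k))\<^sup>2)"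
  proof (rule bounded_imp_summable)
    fix N
    have left: "(\<lambda>n. \<Sum>k\<le>N. (cmod (cinner (b n) (r k)))\<^sup>2) sums (\<Sum>k\<le>N. (norm (r k))\<^sup>2)"
      by (intro sums_sum Parseval_norm b)
    have le: "(\<Sum>k\<le>N. (cmod (cinner (b n) (r k)))\<^sup>2) \<le> Re (cinner (b n) (P (b n)))" for n
      using r_le[of "b n" "Suc N"] by (subst cinner_commute) (simp add: lessThan_Suc_atMost)
    show "(\<Sum>k\<le>N. (norm (r k))\<^sup>2) \<le> (\<Sum>n. Re (cinner (b n) (P (b n))))"
      by (rule sums_le[OF le left summable_sums[OF summable]])
  qed simp
  have CL: "C (L N x) = C x - (\<Sum>k<N. cinner (r k) x *\<^sub>C s k)" for N x
  proof (induction N)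
    case 0
    then show ?case by (simp add: L_def)
  next
    case (Suc N)
    have "complex_of_real (1 / sqrt (d N)) * complex_of_real (1 / sqrt (d N)) = 1 / complex_of_real (d N)"
      using d(2)[of N] by (simp flip: of_real_mult)
    then have "cinner (r N) x *\<^sub>C s N
        = (cinner (Q N (b N)) x / cinner (b N) (Q N (b N))) *\<^sub>C C (L N (b N))"
      unfolding r_def s_def cinner_scaleC_left scaleC_scaleC d by (simp add: mult_ac)
    then show ?case
      unfolding L_Suc C_diff bounded_op_scaleC[OF C] using Suc by simp
  qed
  obtain K where K: "\<And>x. norm (C x) \<le> K * norm x" using bounded_op_bound[OF C] by blast
  have "(\<lambda>N. norm (C (L N x))) \<longlonglongrightarrow> 0" for x
  proof (rule seminorms_tendsto_zero[OF b, where M = "K + (\<Sum>k. (norm (r k))\<^sup>2)"])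
    show "norm (C (L N (x + y))) \<le> norm (C (L N x)) + norm (C (L N y))" for N x y
    proof -
      have "C (L N (x + y)) = C (L N x) + C (L N y)"
        unfolding CL by (simp add: bounded_op_add[OF C] cinner_add_right scaleC_add_left sum.distrib)
      then show ?thesis by (simp add: norm_triangle_ineq)
    qed
    have "C (L N (a *\<^sub>C x)) = a *\<^sub>C C (L N x)" for N a x
      unfolding CL by (simp add: bounded_op_scaleC[OF C] cinner_scaleC_right scaleC_scaleC
          complex_vector.scale_right_diff_distrib complex_vector.scale_sum_right)
    then show "norm (C (L N (a *\<^sub>C x))) = cmod a * norm (C (L N x))" for N a x
      by (simp add: norm_scaleC)
    show "norm (C (L N x)) \<le> (K + (\<Sum>k. (norm (r k))\<^sup>2)) * norm x" for N x
    proof -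
      have "norm (\<Sum>k<N. cinner (r k) x *\<^sub>C s k) \<le> (\<Sum>k<N. (norm (r k))\<^sup>2 * norm x)"
      proof (rule sum_norm_le)
        show "norm (cinner (r k) x *\<^sub>C s k) \<le> (norm (r k))\<^sup>2 * norm x" for k
          using mult_right_mono[OF cmod_cinner_le[of "r k" x], of "norm (r k)"]
          by (simp add: norm_scaleC norm_rs power2_eq_square mult_ac)
      qed
      also have "\<dots> \<le> (\<Sum>k. (norm (r k))\<^sup>2) * norm x"
        unfolding sum_distrib_right[symmetric]
        by (intro mult_right_mono sum_le_suminf r_summable) auto
      finally show ?thesis
        unfolding CL using norm_triangle_ineq4[of "C x" "\<Sum>k<N. cinner (r k) x *\<^sub>C s k"] K[of x]
        by (simp add: distrib_right)
    qed
    have "norm (C (L N (b j))) = 0" if "N \<ge> Suc j" for N j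
      using Q_zero[of j N] that by (simp add: norm_eq Q_def)
    then show "(\<lambda>N. norm (C (L N (b j)))) \<longlonglongrightarrow> 0" for j
      by (intro tendsto_eventually eventually_sequentiallyI[of "Suc j"])
  qed simp
  then have "(\<lambda>N. C x - C (L N x)) \<longlonglongrightarrow> C x - 0" for x
    by (intro tendsto_diff tendsto_const) (rule tendsto_norm_zero_cancel)
  then have "(\<lambda>k. cinner (r k) x *\<^sub>C s k) sums C x" for x
    by (simp add: sums_def CL)
  with norm_rs r_summable show thesis by (rule that)
qed

lemma trace_class_decomposition:
  fixes C :: "'a::complex_hilbert_space \<Rightarrow> 'a"
  assumes infinite_dim: "cinfinite_dimensional TYPE('a)"
    and separable: "separable_space (euclidean :: 'a topology)"
    and C: "trace_class C"
  obtains r s where "\<And>k. norm (s k) = norm (r k)" "summable (\<lambda>k. (norm (r k))\<^sup>2)"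
    "\<And>x. (\<lambda>k. cinner (r k) x *\<^sub>C s k) sums C x"
proof -
  have C': "bounded_op C" using C by (simp add: trace_class_def)
  obtain P B where P: "is_abs_op C P" and B: "orthonormal_basis B"
    and summ: "(\<lambda>e. cinner e (P e)) summable_on B"
    using C unfolding trace_class_def by blast
  obtain b where b: "orthonormal_basis_sequence b" "bij_betw b UNIV B"
    using orthonormal_basis_enumeration[OF infinite_dim separable B] by blast
  have pos: "positive_op P" and PP: "P (P x) = adj C (C x)" for x
    using P by (auto simp: is_abs_op_def fun_eq_iff)
  have norm_eq: "norm (C x) = norm (P x)" for x
    using cinner_adj_right[OF C', of x "C x"]
    by (simp add: norm_eq_sqrt_cinner positive_op_hermitian[OF pos] PP)
  have "(\<lambda>n. Re (cinner (b n) (P (b n)))) summable_on UNIV"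
    using summable_on_Re[OF summ] summable_on_reindex_bij_betw[OF b(2)] by fastforce
  then have summ': "summable (\<lambda>n. Re (cinner (b n) (P (b n))))" by (rule summable_on_imp_summable)
  show thesis
  proof (rule nuclear_decomposition[OF b(1) C' pos norm_eq summ'])
    fix r s :: "nat \<Rightarrow> 'a"
    assume "\<And>k. norm (s k) = norm (r k)" "summable (\<lambda>k. (norm (r k))\<^sup>2)"
      "\<And>x. (\<lambda>k. cinner (r k) x *\<^sub>C s k) sums C x"
    then show thesis by (rule that)
  qed
qed

text \<open>In terms of the decomposition, \<open>tr(CA) = \<Sum>\<^sub>n \<Sum>\<^sub>k \<langle>r\<^sub>k, A b\<^sub>n\<rangle> \<langle>b\<^sub>n, s\<^sub>k\<rangle>\<close>. The double series converges
  absolutely, and summing over the basis first removes it by Parseval's identity.\<close>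

lemma trace_op_decomposition:
  fixes C A :: "'a::complex_hilbert_space \<Rightarrow> 'a"
  assumes infinite_dim: "cinfinite_dimensional TYPE('a)"
    and separable: "separable_space (euclidean :: 'a topology)"
    and basis: "orthonormal_basis (B :: 'a set)"
    and norm_rs: "\<And>k. norm (s k) = norm (r k)" and summ: "summable (\<lambda>k. (norm (r k))\<^sup>2)"
    and C: "\<And>x. (\<lambda>k. cinner (r k) x *\<^sub>C s k) sums C x"
    and A: "bounded_op A"
  shows "(\<lambda>k. cinner (r k) (A (s k))) sums trace_op (C \<circ> A)"
proof -
  define B0 :: "'a set" where "B0 = (SOME B. orthonormal_basis B)"
  have "orthonormal_basis B0" unfolding B0_def using basis by (rule someI)
  then obtain b where b: "orthonormal_basis_sequence b" "bij_betw b UNIV B0"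
    using orthonormal_basis_enumeration[OF infinite_dim separable] by blast
  obtain K where K: "K \<ge> 0" "\<And>x. norm (adj A x) \<le> K * norm x"
    using bounded_op_bound[OF bounded_op_adj[OF A]] by blast
  define h where "h k n = cinner (r k) (A (b n)) * cinner (b n) (s k)" for k n
  have h: "h k n = cinner (adj A (r k)) (b n) * cinner (b n) (s k)" for k n
    by (simp add: h_def cinner_adj[OF A])
  have h_summable: "summable (\<lambda>n. norm (h k n))" for k
    unfolding h by (rule Parseval_absolute[OF b(1)])
  have h_le: "(\<Sum>n. norm (h k n)) \<le> (K\<^sup>2 + 1) * (norm (r k))\<^sup>2" for k
  proof -
    have "(\<Sum>n. norm (h k n)) \<le> (norm (adj A (r k)))\<^sup>2 + (norm (s k))\<^sup>2"
      unfolding h by (rule Parseval_absolute[OF b(1)])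
    also have "(norm (adj A (r k)))\<^sup>2 \<le> (K * norm (r k))\<^sup>2" by (intro power_mono K) simp
    finally show ?thesis by (simp add: norm_rs power_mult_distrib algebra_simps)
  qed
  have row: "(\<lambda>n. norm (h k n)) summable_on UNIV" "infsum (\<lambda>n. norm (h k n)) UNIV = (\<Sum>n. norm (h k n))" for k
    using norm_summable_imp_has_sum[of "\<lambda>n. norm (h k n)"] h_summable[of k]
    by (auto simp: summable_on_def summable_sums infsumI)
  have "(\<lambda>k. norm (infsum (\<lambda>n. norm (h k n)) UNIV)) summable_on UNIV"
  proof (rule norm_summable_imp_summable_on, rule summable_comparison_test'[of _ 0])
    show "summable (\<lambda>k. (K\<^sup>2 + 1) * (norm (r k))\<^sup>2)" by (intro summable_mult summ)
    show "norm (norm (norm (infsum (\<lambda>n. norm (h k n)) UNIV))) \<le> (K\<^sup>2 + 1) * (norm (r k))\<^sup>2" for k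
      using h_le[of k] suminf_nonneg[OF h_summable[of k]] by (simp add: row(2))
  qed
  then have "(\<lambda>(k, n). h k n) summable_on UNIV \<times> UNIV"
    using row(1) Infinite_Sum.abs_summable_on_Sigma_iff[of "\<lambda>(k, n). h k n" UNIV "\<lambda>_. UNIV"]
    by (subst abs_summable_summable) simp_all
  then have swap: "infsum (\<lambda>k. infsum (h k) UNIV) UNIV = infsum (\<lambda>n. infsum (\<lambda>k. h k n) UNIV) UNIV"
    by (rule infsum_swap_banach)
  have "infsum (h k) UNIV = cinner (r k) (A (s k))" for k
  proof -
    have "h k sums cinner (adj A (r k)) (s k)"
      unfolding h[abs_def] by (rule Parseval[OF b(1)])
    from norm_summable_imp_has_sum[OF h_summable this] show ?thesis
      by (simp add: infsumI cinner_adj[OF A])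
  qed
  moreover have "infsum (\<lambda>k. h k n) UNIV = cinner (b n) (C (A (b n)))" for n
  proof -
    have "(\<lambda>k. h k n) sums cinner (b n) (C (A (b n)))"
      using bounded_linear.sums[OF bounded_bilinear.bounded_linear_right[OF bounded_bilinear_cinner]
          C[of "A (b n)"], of "b n"]
      by (simp add: cinner_scaleC_right h_def)
    moreover have "summable (\<lambda>k. norm (h k n))"
    proof (rule summable_comparison_test'[of _ 0])
      show "summable (\<lambda>k. norm (A (b n)) * norm (b n) * (norm (r k))\<^sup>2)"
        by (intro summable_mult summ)
      show "norm (norm (h k n)) \<le> norm (A (b n)) * norm (b n) * (norm (r k))\<^sup>2" for k
        using mult_mono[OF cmod_cinner_le[of "r k" "A (b n)"] cmod_cinner_le[of "b n" "s k"]]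
        by (simp add: h_def norm_mult norm_rs power2_eq_square mult_ac)
    qed
    ultimately show ?thesis by (intro infsumI norm_summable_imp_has_sum)
  qed
  ultimately have eq: "infsum (\<lambda>k. cinner (r k) (A (s k))) UNIV
      = infsum (\<lambda>n. cinner (b n) (C (A (b n)))) UNIV"
    using swap by simp
  also have "\<dots> = trace_op (C \<circ> A)"
    unfolding trace_op_def B0_def[symmetric]
    using infsum_reindex_bij_betw[OF b(2), of "\<lambda>e. cinner e (C (A e))"] by simp
  finally have trace: "infsum (\<lambda>k. cinner (r k) (A (s k))) UNIV = trace_op (C \<circ> A)" .
  have "summable (\<lambda>k. norm (cinner (r k) (A (s k))))"
  proof (rule summable_comparison_test'[of _ 0])
    show "summable (\<lambda>k. K * (norm (r k))\<^sup>2)" by (intro summable_mult summ)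
    show "norm (norm (cinner (r k) (A (s k)))) \<le> K * (norm (r k))\<^sup>2" for k
      using cmod_cinner_le[of "adj A (r k)" "s k"] mult_right_mono[OF K(2)[of "r k"], of "norm (r k)"]
      by (simp add: cinner_adj[OF A] norm_rs power2_eq_square)
  qed
  then have "(\<lambda>k. cinner (r k) (A (s k))) summable_on UNIV" by (rule norm_summable_imp_summable_on)
  from has_sum_infsum[OF this] show ?thesis unfolding trace by (rule has_sum_imp_sums)
qed

lemma trace_class_basis:
  fixes C :: "'a::complex_hilbert_space \<Rightarrow> 'a"
  assumes "trace_class C"
  obtains B :: "'a set" where "orthonormal_basis B"
  using assms unfolding trace_class_def by blast

lemma bounded_op_combination:
  assumes S: "bounded_op S" and T: "bounded_op T"
  shows "bounded_op (\<lambda>x. \<alpha> *\<^sub>C S x + \<beta> *\<^sub>C T x)"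
proof -
  obtain K L where K: "\<And>x. norm (S x) \<le> K * norm x" and L: "\<And>x. norm (T x) \<le> L * norm x"
    using assms[THEN bounded_op_bound] by blast
  show ?thesis
  proof (rule bounded_opI[where K = "cmod \<alpha> * K + cmod \<beta> * L"])
    show "norm (\<alpha> *\<^sub>C S x + \<beta> *\<^sub>C T x) \<le> (cmod \<alpha> * K + cmod \<beta> * L) * norm x" for x
    proof -
      have "norm (\<alpha> *\<^sub>C S x + \<beta> *\<^sub>C T x) \<le> cmod \<alpha> * norm (S x) + cmod \<beta> * norm (T x)"
        using norm_triangle_ineq[of "\<alpha> *\<^sub>C S x"] by (metis norm_scaleC)
      also have "\<dots> \<le> cmod \<alpha> * (K * norm x) + cmod \<beta> * (L * norm x)"
        by (intro add_mono mult_left_mono K L norm_ge_zero)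
      finally show ?thesis by (simp add: algebra_simps)
    qed
  qed (simp_all add: bounded_op_add[OF S] bounded_op_add[OF T] bounded_op_scaleC[OF S]
      bounded_op_scaleC[OF T] scaleC_add_right scaleC_scaleC mult.commute)
qed

context
  assumes infinite_dim: "cinfinite_dimensional TYPE('a::complex_hilbert_space)"
    and separable: "separable_space (euclidean :: 'a topology)"
begin

lemma trace_op_combination:
  fixes C S T :: "'a \<Rightarrow> 'a"
  assumes C: "trace_class C" and S: "bounded_op S" and T: "bounded_op T"
  shows "trace_op (C \<circ> (\<lambda>x. \<alpha> *\<^sub>C S x + \<beta> *\<^sub>C T x)) = \<alpha> * trace_op (C \<circ> S) + \<beta> * trace_op (C \<circ> T)"
proof -
  obtain r s where rs: "\<And>k. norm (s k) = norm (r k)" "summable (\<lambda>k. (norm (r k))\<^sup>2)"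
    "\<And>x. (\<lambda>k. cinner (r k) x *\<^sub>C s k) sums C x"
    using trace_class_decomposition[OF infinite_dim separable C] by metis
  obtain B :: "'a set" where B: "orthonormal_basis B" using trace_class_basis[OF C] .
  note trace = trace_op_decomposition[OF infinite_dim separable B rs]
  have "(\<lambda>k. \<alpha> * cinner (r k) (S (s k)) + \<beta> * cinner (r k) (T (s k)))
      sums (\<alpha> * trace_op (C \<circ> S) + \<beta> * trace_op (C \<circ> T))"
    by (intro sums_add sums_mult trace S T)
  then show ?thesis
    using trace[OF bounded_op_combination[OF S T]]
    by (simp add: cinner_add_right cinner_scaleC_right sums_iff)
qed

text \<open>On norm-bounded sets the functional \<open>A \<mapsto> tr(CA)\<close> is continuous for the weak operator
  topology: the nuclear decomposition dominates the traces \<open>\<Sum>\<^sub>k \<langle>r\<^sub>k, A\<^sub>n s\<^sub>k\<rangle>\<close> by a multiple of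
  \<open>\<Sum>\<^sub>k \<parallel>r\<^sub>k\<parallel>\<^sup>2\<close>, and convergence of the matrix entries spreads to all pairs of vectors in one
  argument at a time.\<close>

lemma trace_op_weakly_continuous:
  fixes C T :: "'a \<Rightarrow> 'a" and A :: "nat \<Rightarrow> 'a \<Rightarrow> 'a"
  assumes C: "trace_class C" and T: "bounded_op T"
    and b: "orthonormal_basis_sequence b"
    and A: "\<And>n. bounded_op (A n)" and bound: "\<And>n x. norm (A n x) \<le> K * norm x"
    and entries: "\<And>i j. (\<lambda>n. cinner (b i) (A n (b j))) \<longlonglongrightarrow> cinner (b i) (T (b j))"
  shows "(\<lambda>n. trace_op (C \<circ> A n)) \<longlonglongrightarrow> trace_op (C \<circ> T)"
proof -
  obtain r s where rs: "\<And>k. norm (s k) = norm (r k)" "summable (\<lambda>k. (norm (r k))\<^sup>2)"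
    "\<And>x. (\<lambda>k. cinner (r k) x *\<^sub>C s k) sums C x"
    using trace_class_decomposition[OF infinite_dim separable C] by metis
  obtain B :: "'a set" where B: "orthonormal_basis B" using trace_class_basis[OF C] .
  note trace = trace_op_decomposition[OF infinite_dim separable B rs]
  obtain L where L: "\<And>x. norm (T x) \<le> L * norm x"
    using bounded_op_bound[OF T] by blast
  define D where "D n x y = cinner x (A n y) - cinner x (T y)" for n x y
  have D_le: "cmod (D n x y) \<le> norm x * ((K + L) * norm y)" for n x y
  proof -
    have "D n x y = cinner x (A n y - T y)" by (simp add: D_def cinner_diff_right)
    then have "cmod (D n x y) \<le> norm x * norm (A n y - T y)" by (simp add: cmod_cinner_le)
    also have "norm (A n y - T y) \<le> (K + L) * norm y"
      using norm_triangle_ineq4[of "A n y" "T y"] bound[of n y] L[of y] by (simp add: algebra_simps)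
    finally show ?thesis by (simp add: mult_left_mono)
  qed
  have D_add: "D n x (y + z) = D n x y + D n x z" "D n (x + z) y = D n x y + D n z y" for n x y z
    by (simp_all add: D_def bounded_op_add[OF A] bounded_op_add[OF T] cinner_add_left cinner_add_right)
  have D_scale: "D n x (a *\<^sub>C y) = a * D n x y" "D n (a *\<^sub>C x) y = cnj a * D n x y" for n a x y
    by (simp_all add: D_def bounded_op_scaleC[OF A] bounded_op_scaleC[OF T] cinner_scaleC_left
        cinner_scaleC_right algebra_simps)
  have D_basis: "(\<lambda>n. cmod (D n (b i) (b j))) \<longlonglongrightarrow> 0" for i j
    using tendsto_norm_zero[OF LIM_zero[OF entries[of i j]]] by (simp add: D_def)
  have D_row: "(\<lambda>n. cmod (D n (b i) y)) \<longlonglongrightarrow> 0" for i y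
    by (rule seminorms_tendsto_zero[OF b, where M = "norm (b i) * (K + L)"])
       (use D_le[of _ "b i"] D_basis in \<open>simp_all add: D_add D_scale norm_triangle_ineq norm_mult mult.assoc\<close>)
  have D_lim: "(\<lambda>n. cmod (D n x y)) \<longlonglongrightarrow> 0" for x y
    by (rule seminorms_tendsto_zero[OF b, where M = "(K + L) * norm y"])
       (use D_le[of _ _ y] D_row in \<open>simp_all add: D_add D_scale norm_triangle_ineq norm_mult mult_ac\<close>)
  have "(\<lambda>n. \<Sum>k. D n (r k) (s k)) \<longlonglongrightarrow> (\<Sum>k. 0 :: complex)"
  proof (intro tannerys_theorem[THEN conjunct2, THEN conjunct2] always_eventually allI)
    show "(\<lambda>n. D n (r k) (s k)) \<longlonglongrightarrow> 0" for k
      by (rule tendsto_norm_zero_cancel) (rule D_lim)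
    show "case p of (k, n) \<Rightarrow> cmod (D n (r k) (s k)) \<le> (K + L) * (norm (r k))\<^sup>2" for p
      using D_le[of "snd p" "r (fst p)" "s (fst p)"]
      by (simp add: case_prod_beta rs(1) power2_eq_square mult_ac)
    show "summable (\<lambda>k. (K + L) * (norm (r k))\<^sup>2)" by (intro summable_mult rs(2))
  qed simp
  moreover have "(\<Sum>k. D n (r k) (s k)) = trace_op (C \<circ> A n) - trace_op (C \<circ> T)" for n
    unfolding D_def by (intro sums_unique[symmetric] sums_diff trace A T)
  ultimately show ?thesis by (simp add: LIM_zero_iff)
qed

end

section \<open>Rotating a basis towards a singular sequence\<close>

text \<open>The plane rotation acts on \<open>span {e, g}\<close> and fixes its orthogonal complement; its adjoint and
  its inverse are both the rotation by the opposite angle.\<close>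

lemma Givens_rotation:
  fixes e g :: "'a::complex_hilbert_space" and c s :: real
  assumes e: "cinner e e = 1" and g: "cinner g g = 1" and eg: "cinner e g = 0"
    and cs: "c\<^sup>2 + s\<^sup>2 = 1"
  obtains R where "unitary_op R" "R e = complex_of_real c *\<^sub>C e + complex_of_real s *\<^sub>C g"
    "\<And>x. \<lbrakk>cinner e x = 0; cinner g x = 0\<rbrakk> \<Longrightarrow> R x = x"
proof -
  have ge: "cinner g e = 0" using eg by (subst cinner_commute) simp
  define R where "R s x = x + (complex_of_real c * cinner e x - complex_of_real s * cinner g x - cinner e x) *\<^sub>C e
      + (complex_of_real s * cinner e x + complex_of_real c * cinner g x - cinner g x) *\<^sub>C g" for s :: real and x
  note simps = cinner_add_left cinner_add_right cinner_scaleC_left cinner_scaleC_right e g eg ge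
  have add: "R s (x + y) = R s x + R s y" for s x y
    by (simp add: R_def cinner_add_right algebra_simps scaleC_add_left complex_vector.scale_left_diff_distrib)
  have scale: "R s (a *\<^sub>C x) = a *\<^sub>C R s x" for s a x
    by (simp add: R_def cinner_scaleC_right scaleC_add_right scaleC_scaleC algebra_simps)
  have inverse: "R (- s) (R s x) = x" if "c\<^sup>2 + s\<^sup>2 = 1" for s x
  proof -
    define a b where "a = cinner e x" and "b = cinner g x"
    define a' b' where "a' = complex_of_real c * a - complex_of_real s * b"
      and "b' = complex_of_real s * a + complex_of_real c * b"
    have cs': "complex_of_real c * complex_of_real c + complex_of_real s * complex_of_real s = 1"
      using arg_cong[OF that, of complex_of_real] by (simp add: power2_eq_square)
    have Rx: "R s x = x + (a' - a) *\<^sub>C e + (b' - b) *\<^sub>C g"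
      by (simp add: R_def a_def b_def a'_def b'_def)
    have "cinner e (R s x) = a'" "cinner g (R s x) = b'"
      unfolding Rx by (simp_all add: simps a_def b_def)
    then have "R (- s) (R s x) = R s x + (complex_of_real c * a' + complex_of_real s * b' - a') *\<^sub>C e
        + (complex_of_real c * b' - complex_of_real s * a' - b') *\<^sub>C g"
      unfolding R_def[of "- s"] by (simp add: algebra_simps)
    also have "complex_of_real c * a' + complex_of_real s * b'
        = (complex_of_real c * complex_of_real c + complex_of_real s * complex_of_real s) * a"
      by (simp add: a'_def b'_def algebra_simps)
    also have "complex_of_real c * b' - complex_of_real s * a'
        = (complex_of_real c * complex_of_real c + complex_of_real s * complex_of_real s) * b"
      by (simp add: a'_def b'_def algebra_simps)
    finally show ?thesis
      unfolding cs' Rx by (simp add: complex_vector.scale_left_diff_distrib)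
  qed
  have adjoint: "cinner (R s x) y = cinner x (R (- s) y)" for x y
    unfolding R_def cinner_add_left cinner_add_right cinner_scaleC_left cinner_scaleC_right
    by (simp add: cinner_commute[of x e] cinner_commute[of x g] algebra_simps)
  show thesis
  proof (rule that)
    show "unitary_op (R s)"
    proof (rule unitary_opI)
      show "cinner (R s x) (R s y) = cinner x y" for x y
        unfolding adjoint by (simp add: inverse cs)
      show "surj (R s)"
        using inverse[of "- s"] cs by (metis add.inverse_inverse power2_minus surjI)
    qed (fact add scale)+
    show "R s e = complex_of_real c *\<^sub>C e + complex_of_real s *\<^sub>C g"
      by (simp add: R_def e ge complex_vector.scale_left_diff_distrib scaleC_one)
    show "R s x = x" if "cinner e x = 0" "cinner g x = 0" for x
      using that by (simp add: R_def)
  qed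
qed

text \<open>The rotations take place in mutually orthogonal planes, so their product performs them all.
  That it fixes the common orthogonal complement is what carries the induction.\<close>

lemma simultaneous_rotation:
  fixes e g :: "nat \<Rightarrow> 'a::complex_hilbert_space" and c s :: real
  assumes e: "\<And>i j. \<lbrakk>i < m; j < m\<rbrakk> \<Longrightarrow> cinner (e i) (e j) = (if i = j then 1 else 0)"
    and g: "\<And>i j. \<lbrakk>i < m; j < m\<rbrakk> \<Longrightarrow> cinner (g i) (g j) = (if i = j then 1 else 0)"
    and eg: "\<And>i j. \<lbrakk>i < m; j < m\<rbrakk> \<Longrightarrow> cinner (e i) (g j) = 0"
    and cs: "c\<^sup>2 + s\<^sup>2 = 1"
  shows "\<exists>V. unitary_op V \<and> (\<forall>i<m. V (e i) = complex_of_real c *\<^sub>C e i + complex_of_real s *\<^sub>C g i)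
    \<and> (\<forall>x. (\<forall>i<m. cinner (e i) x = 0 \<and> cinner (g i) x = 0) \<longrightarrow> V x = x)"
  using e g eg
proof (induction m)
  case 0
  have "unitary_op id"
    by (rule unitary_opI) simp_all
  then show ?case by auto
next
  case (Suc m)
  have ge: "cinner (g i) (e j) = 0" if "i < Suc m" "j < Suc m" for i j
    using Suc.prems(3)[OF that(2,1)] by (subst cinner_commute) simp
  have "\<exists>V. unitary_op V \<and> (\<forall>i<m. V (e i) = complex_of_real c *\<^sub>C e i + complex_of_real s *\<^sub>C g i)
    \<and> (\<forall>x. (\<forall>i<m. cinner (e i) x = 0 \<and> cinner (g i) x = 0) \<longrightarrow> V x = x)"
    by (rule Suc.IH) (simp_all add: Suc.prems)
  then obtain V where V: "unitary_op V" "\<And>i. i < m \<Longrightarrow> V (e i) = complex_of_real c *\<^sub>C e i + complex_of_real s *\<^sub>C g i"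
    "\<And>x. (\<forall>i<m. cinner (e i) x = 0 \<and> cinner (g i) x = 0) \<Longrightarrow> V x = x"
    by blast
  obtain R where R: "unitary_op R" "R (e m) = complex_of_real c *\<^sub>C e m + complex_of_real s *\<^sub>C g m"
    "\<And>x. \<lbrakk>cinner (e m) x = 0; cinner (g m) x = 0\<rbrakk> \<Longrightarrow> R x = x"
    using Givens_rotation[of "e m" "g m" c s] Suc.prems cs by (metis lessI)
  have "(V \<circ> R) (e i) = complex_of_real c *\<^sub>C e i + complex_of_real s *\<^sub>C g i" if i: "i < Suc m" for i
  proof (cases "i = m")
    case True
    have "cinner (e j) (R (e m)) = 0 \<and> cinner (g j) (R (e m)) = 0" if "j < m" for j
      using that Suc.prems(1)[of j m] Suc.prems(2)[of j m] Suc.prems(3)[of j m] ge[of j m]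
      by (simp add: R(2) cinner_add_right cinner_scaleC_right)
    then have "V (R (e m)) = R (e m)" by (intro V(3)) blast
    then show ?thesis using True R(2) by simp
  next
    case False
    then have "R (e i) = e i"
      using i Suc.prems(1)[of m i] ge[of m i] by (intro R(3)) simp_all
    then show ?thesis using i False V(2) by simp
  qed
  moreover have "(V \<circ> R) x = x" if "\<forall>i<Suc m. cinner (e i) x = 0 \<and> cinner (g i) x = 0" for x
    using that R(3)[of x] V(3)[of x] by simp
  ultimately show ?case using unitary_op_compose[OF V(1) R(1)] by blast
qed

text \<open>An orthonormal sequence \<open>f\<close> that realizes \<open>\<mu>\<close> tends weakly to zero. Hence removing the
  components along the finite set \<open>F\<close> and renormalizing is an asymptotically negligible
  change, and every fixed vector becomes nearly orthogonal both to \<open>T f\<^sub>n\<close> and, after applying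
  \<open>T\<close>, to \<open>f\<^sub>n\<close>.\<close>

lemma essential_direction:
  assumes T: "bounded_op (T :: 'a::complex_hilbert_space \<Rightarrow> 'a)"
    and \<mu>: "\<mu> \<in> essential_numerical_range T"
    and F: "finite F" "orthonormal_set F" and "\<epsilon> > 0"
  obtains g where "cinner g g = 1" "\<And>x. x \<in> F \<Longrightarrow> cinner x g = 0"
    "cmod (cinner g (T g) - \<mu>) < \<epsilon>"
    "\<And>x. x \<in> F \<Longrightarrow> cmod (cinner x (T g)) < \<epsilon>" "\<And>x. x \<in> F \<Longrightarrow> cmod (cinner g (T x)) < \<epsilon>"
proof -
  obtain f where f: "orthonormal_sequence f" and lim: "(\<lambda>n. cinner (f n) (T (f n))) \<longlonglongrightarrow> \<mu>"
    using \<mu> by (auto simp: essential_numerical_range_def)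
  have norm_f: "norm (f n) = 1" for n
    using f by (simp add: orthonormal_sequence_def norm_eq_sqrt_cinner)
  note weak = orthonormal_sequence_weakly_null[OF f]
  obtain K where K: "\<And>x. norm (T x) \<le> K * norm x" using bounded_op_bound[OF T] by blast
  \<comment> \<open>the component of \<open>f n\<close> in the span of \<open>F\<close>\<close>
  define u where "u n = (\<Sum>x\<in>F. cinner x (f n) *\<^sub>C x)" for n
  have "u \<longlonglongrightarrow> 0"
  proof (rule tendsto_norm_zero_cancel, rule Lim_null_comparison[OF always_eventually])
    show "\<forall>n. norm (norm (u n)) \<le> (\<Sum>x\<in>F. cmod (cinner x (f n)) * norm x)"
      unfolding u_def by (auto intro: sum_norm_le simp: norm_scaleC)
    show "(\<lambda>n. \<Sum>x\<in>F. cmod (cinner x (f n)) * norm x) \<longlonglongrightarrow> 0"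
      using weak by (intro tendsto_null_sum tendsto_mult_left_zero tendsto_norm_zero)
  qed
  note u = this
  define k where "k n = complex_of_real (1 / norm (f n - u n))" for n
  define g where "g n = k n *\<^sub>C (f n - u n)" for n
  have "(\<lambda>n. norm (f n - u n) - norm (f n)) \<longlonglongrightarrow> 0"
  proof (rule Lim_null_comparison[OF always_eventually])
    show "\<forall>n. norm (norm (f n - u n) - norm (f n)) \<le> norm (u n)"
    proof
      show "norm (norm (f n - u n) - norm (f n)) \<le> norm (u n)" for n
        using norm_triangle_ineq3[of "f n - u n" "f n"] by simp
    qed
  qed (rule tendsto_norm_zero[OF u])
  then have norm_lim: "(\<lambda>n. norm (f n - u n)) \<longlonglongrightarrow> 1"
    by (simp add: norm_f LIM_zero_iff)
  then have "k \<longlonglongrightarrow> complex_of_real (1 / 1)"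
    unfolding k_def by (intro tendsto_intros) simp_all
  then have k: "k \<longlonglongrightarrow> 1" by simp
  have g_null: "(\<lambda>n. cinner x (g n)) \<longlonglongrightarrow> 0" for x
    using tendsto_mult[OF k tendsto_diff[OF weak[of x] tendsto_cinner[OF tendsto_const[of x] u]]]
    by (simp add: g_def cinner_scaleC_right cinner_diff_right cinner_zero_right)
  have "(\<lambda>n. cinner (f n) (T (u n))) \<longlonglongrightarrow> 0" "(\<lambda>n. cinner (u n) (T (f n))) \<longlonglongrightarrow> 0"
  proof -
    have Tu: "(\<lambda>n. T (u n)) \<longlonglongrightarrow> 0"
      using bounded_linear.tendsto[OF bounded_op_linear[OF T] u]
      by (simp add: linear_0 bounded_linear.linear[OF bounded_op_linear[OF T]])
    show "(\<lambda>n. cinner (f n) (T (u n))) \<longlonglongrightarrow> 0"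
      by (rule Lim_null_comparison[OF always_eventually tendsto_norm_zero[OF Tu]])
         (use cmod_cinner_le[of "f _"] in \<open>simp add: norm_f\<close>)
    show "(\<lambda>n. cinner (u n) (T (f n))) \<longlonglongrightarrow> 0"
    proof (rule Lim_null_comparison[OF always_eventually])
      show "\<forall>n. norm (cinner (u n) (T (f n))) \<le> norm (u n) * K"
        using order_trans[OF cmod_cinner_le[of "u _" "T (f _)"] mult_left_mono[OF K]] by (simp add: norm_f)
      show "(\<lambda>n. norm (u n) * K) \<longlonglongrightarrow> 0"
        by (intro tendsto_mult_left_zero tendsto_norm_zero u)
    qed
  qed
  note cross = this
  have Tu: "(\<lambda>n. cinner (u n) (T (u n))) \<longlonglongrightarrow> 0"
    using tendsto_cinner[OF u bounded_linear.tendsto[OF bounded_op_linear[OF T] u]]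
    by (simp add: cinner_zero_left)
  have "cinner (g n) (T (g n)) = k n * k n * (cinner (f n) (T (f n)) - cinner (f n) (T (u n))
      - (cinner (u n) (T (f n)) - cinner (u n) (T (u n))))" for n
  proof -
    have T_diff: "T (f n - u n) = T (f n) - T (u n)"
      using bounded_op_linear[OF T] by (simp add: bounded_linear.linear linear_diff)
    have "cnj (k n) = k n" by (simp add: k_def)
    then show ?thesis
      unfolding g_def bounded_op_scaleC[OF T] cinner_scaleC_left cinner_scaleC_right T_diff
        cinner_diff_left cinner_diff_right by (simp add: algebra_simps)
  qed
  then have g_lim: "(\<lambda>n. cinner (g n) (T (g n))) \<longlonglongrightarrow> \<mu>"
    using tendsto_mult[OF tendsto_mult[OF k k] tendsto_diff[OF tendsto_diff[OF lim cross(1)]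
          tendsto_diff[OF cross(2) Tu]]] by simp
  have ev1: "\<forall>\<^sub>F n in sequentially. cinner (g n) (g n) = 1"
  proof -
    have "\<forall>\<^sub>F n in sequentially. norm (f n - u n) > 0"
      using order_tendstoD(1)[OF norm_lim, of 0] by simp
    then show ?thesis
    proof eventually_elim
      case (elim n)
      then have "norm (g n) = 1" by (simp add: g_def k_def norm_scaleC norm_divide)
      then show ?case by (simp add: cinner_self)
    qed
  qed
  have ev2: "\<forall>\<^sub>F n in sequentially. cmod (cinner (g n) (T (g n)) - \<mu>) < \<epsilon>"
    using tendstoD[OF g_lim \<open>\<epsilon> > 0\<close>] by (simp add: dist_norm)
  have ev3: "\<forall>\<^sub>F n in sequentially. \<forall>x\<in>F. cmod (cinner x (T (g n))) < \<epsilon>"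
  proof (intro eventually_ball_finite[OF F(1)] ballI)
    show "\<forall>\<^sub>F n in sequentially. cmod (cinner x (T (g n))) < \<epsilon>" for x
      using tendstoD[OF g_null[of "adj T x"] \<open>\<epsilon> > 0\<close>] by (simp add: cinner_adj[OF T])
  qed
  have ev4: "\<forall>\<^sub>F n in sequentially. \<forall>x\<in>F. cmod (cinner (g n) (T x)) < \<epsilon>"
  proof (intro eventually_ball_finite[OF F(1)] ballI)
    show "\<forall>\<^sub>F n in sequentially. cmod (cinner (g n) (T x)) < \<epsilon>" for x
      using tendstoD[OF g_null[of "T x"] \<open>\<epsilon> > 0\<close>] by (subst cinner_commute) simp
  qed
  have orth: "cinner x (g n) = 0" if "x \<in> F" for x n
  proof -
    have "cinner x (u n) = (\<Sum>y\<in>F. cinner y (f n) * (if x = y then 1 else 0))"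
      unfolding u_def cinner_sum_right cinner_scaleC_right
      by (rule sum.cong) (use F(2) that in \<open>auto simp: orthonormal_set_def\<close>)
    also have "\<dots> = cinner x (f n)"
      using F(1) that by (simp add: if_distrib[of "\<lambda>c. _ * c"] cong: if_cong)
    finally show ?thesis by (simp add: g_def cinner_scaleC_right cinner_diff_right)
  qed
  obtain n where "cinner (g n) (g n) = 1" "cmod (cinner (g n) (T (g n)) - \<mu>) < \<epsilon>"
    "\<forall>x\<in>F. cmod (cinner x (T (g n))) < \<epsilon>" "\<forall>x\<in>F. cmod (cinner (g n) (T x)) < \<epsilon>"
    using eventually_happens'[OF sequentially_bot
        eventually_conj[OF ev1 eventually_conj[OF ev2 eventually_conj[OF ev3 ev4]]]] by blast
  then show thesis using that[of "g n"] orth by blast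
qed

text \<open>The vectors are chosen one after the other, each nearly decoupled by \<open>T\<close> from the basis vectors
  and from the vectors chosen before it.\<close>

lemma essential_directions:
  fixes k m :: nat
  assumes T: "bounded_op (T :: 'a::complex_hilbert_space \<Rightarrow> 'a)"
    and \<mu>: "\<mu> \<in> essential_numerical_range T"
    and b: "orthonormal_sequence b" and "\<epsilon> > 0"
  shows "\<exists>g. \<forall>i<k. cinner (g i) (g i) = 1 \<and> cmod (cinner (g i) (T (g i)) - \<mu>) < \<epsilon>
    \<and> (\<forall>j<m. cinner (b j) (g i) = 0 \<and> cmod (cinner (b j) (T (g i))) < \<epsilon> \<and> cmod (cinner (g i) (T (b j))) < \<epsilon>)
    \<and> (\<forall>j<i. cinner (g j) (g i) = 0 \<and> cmod (cinner (g j) (T (g i))) < \<epsilon> \<and> cmod (cinner (g i) (T (g j))) < \<epsilon>)"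
proof (induction k)
  case (Suc k)
  then obtain g where g: "\<And>i. i < k \<Longrightarrow> cinner (g i) (g i) = 1 \<and> cmod (cinner (g i) (T (g i)) - \<mu>) < \<epsilon>
    \<and> (\<forall>j<m. cinner (b j) (g i) = 0 \<and> cmod (cinner (b j) (T (g i))) < \<epsilon> \<and> cmod (cinner (g i) (T (b j))) < \<epsilon>)
    \<and> (\<forall>j<i. cinner (g j) (g i) = 0 \<and> cmod (cinner (g j) (T (g i))) < \<epsilon> \<and> cmod (cinner (g i) (T (g j))) < \<epsilon>)"
    by blast
  \<comment> \<open>everything the new vector has to be decoupled from\<close>
  let ?F = "b ` {..<m} \<union> g ` {..<k}"
  have bg: "cinner (b j) (g i) = 0" "cinner (g i) (b j) = 0" if "i < k" "j < m" for i j
    using g[OF that(1)] that(2) by (simp, subst cinner_commute, simp)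
  have gg: "cinner (g i) (g j) = (if i = j then 1 else 0)" if "i < k" "j < k" for i j
  proof (cases i j rule: linorder_cases)
    case greater
    then have "cinner (g j) (g i) = 0" using g[OF that(1)] by blast
    then show ?thesis using greater by (subst cinner_commute) simp
  qed (use g that in auto)
  have zero: "x \<noteq> y \<longleftrightarrow> cinner x y = 0" if "cinner x x = 1" "cinner x y = 0 \<or> x = y" for x y :: 'a
    using that by auto
  have "orthonormal_set ?F"
    unfolding orthonormal_set_def
  proof (intro ballI)
    fix x y assume "x \<in> ?F" "y \<in> ?F"
    then have "cinner x x = 1" "cinner x y = 0 \<or> x = y"
      using gg bg orthonormal_sequence_cinner[OF b] by auto
    then show "cinner x y = (if x = y then 1 else 0)" using zero by auto
  qed
  then obtain h where h: "cinner h h = 1" "\<And>x. x \<in> ?F \<Longrightarrow> cinner x h = 0"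
    "cmod (cinner h (T h) - \<mu>) < \<epsilon>"
    "\<And>x. x \<in> ?F \<Longrightarrow> cmod (cinner x (T h)) < \<epsilon>" "\<And>x. x \<in> ?F \<Longrightarrow> cmod (cinner h (T x)) < \<epsilon>"
    using essential_direction[OF T \<mu> _ _ \<open>\<epsilon> > 0\<close>, of ?F] by auto
  show ?case
    by (rule exI[of _ "g(k := h)"]) (use g h in \<open>auto simp: less_Suc_eq\<close>)
qed simp

text \<open>Rotating the first basis vectors by \<open>V b\<^sub>i = \<surd>(1 - t) b\<^sub>i + \<surd>t g\<^sub>i\<close> turns the matrix entries of \<open>T\<close> into those of
  \<open>(1 - t) T + t \<mu>\<close>, since all cross terms are small.\<close>

lemma rotated_matrix_entries:
  assumes T: "bounded_op (T :: 'a::complex_hilbert_space \<Rightarrow> 'a)"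
    and \<mu>: "\<mu> \<in> essential_numerical_range T"
    and b: "orthonormal_sequence b" and "\<epsilon> > 0" and t: "t \<in> {0..1::real}"
  obtains V where "unitary_op V" "\<And>i j. \<lbrakk>i < m; j < m\<rbrakk> \<Longrightarrow> cmod (cinner (V (b i)) (T (V (b j)))
      - (complex_of_real (1 - t) * cinner (b i) (T (b j)) + complex_of_real t * \<mu> * cinner (b i) (b j))) < 3 * \<epsilon>"
proof -
  obtain g where g: "\<And>i. i < m \<Longrightarrow> cinner (g i) (g i) = 1 \<and> cmod (cinner (g i) (T (g i)) - \<mu>) < \<epsilon>
    \<and> (\<forall>j<m. cinner (b j) (g i) = 0 \<and> cmod (cinner (b j) (T (g i))) < \<epsilon> \<and> cmod (cinner (g i) (T (b j))) < \<epsilon>)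
    \<and> (\<forall>j<i. cinner (g j) (g i) = 0 \<and> cmod (cinner (g j) (T (g i))) < \<epsilon> \<and> cmod (cinner (g i) (T (g j))) < \<epsilon>)"
    using essential_directions[OF T \<mu> b \<open>\<epsilon> > 0\<close>, of m m] by blast
  have gg: "cinner (g i) (g j) = (if i = j then 1 else 0)" if "i < m" "j < m" for i j
  proof (cases i j rule: linorder_cases)
    case greater
    then have "cinner (g j) (g i) = 0" using g[OF that(1)] by blast
    then show ?thesis using greater by (subst cinner_commute) simp
  qed (use g that in auto)
  have gTg: "cmod (cinner (g i) (T (g j)) - \<mu> * cinner (b i) (b j)) < \<epsilon>" if "i < m" "j < m" for i j
    using g[OF that(1)] g[OF that(2)]
    by (cases i j rule: linorder_cases) (simp_all add: orthonormal_sequence_cinner[OF b])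
  define c s where "c = sqrt (1 - t)" and "s = sqrt t"
  have cs: "c * c = 1 - t" "s * s = t" using t by (simp_all add: c_def s_def)
  have cs_le: "0 \<le> c" "c \<le> 1" "0 \<le> s" "s \<le> 1" using t by (simp_all add: c_def s_def)
  have "c\<^sup>2 + s\<^sup>2 = 1" by (simp add: power2_eq_square cs)
  then have "\<exists>V. unitary_op V \<and> (\<forall>i<m. V (b i) = complex_of_real c *\<^sub>C b i + complex_of_real s *\<^sub>C g i)
    \<and> (\<forall>x. (\<forall>i<m. cinner (b i) x = 0 \<and> cinner (g i) x = 0) \<longrightarrow> V x = x)"
    by (intro simultaneous_rotation) (use g gg in \<open>simp_all add: orthonormal_sequence_cinner[OF b]\<close>)
  then obtain V where V: "unitary_op V" "\<And>i. i < m \<Longrightarrow> V (b i) = complex_of_real c *\<^sub>C b i + complex_of_real s *\<^sub>C g i"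
    by blast
  have "cmod (cinner (V (b i)) (T (V (b j)))
      - (complex_of_real (1 - t) * cinner (b i) (T (b j)) + complex_of_real t * \<mu> * cinner (b i) (b j))) < 3 * \<epsilon>"
    if ij: "i < m" "j < m" for i j
  proof -
    have small: "cmod (complex_of_real (x * y) * z) < \<epsilon>"
      if "0 \<le> x" "x \<le> 1" "0 \<le> y" "y \<le> 1" "cmod z < \<epsilon>" for x y z
    proof -
      have "cmod (complex_of_real (x * y) * z) = x * y * cmod z"
        using that by (simp add: norm_mult)
      also have "\<dots> \<le> 1 * cmod z" using that by (intro mult_right_mono) (auto simp: mult_le_one)
      finally show ?thesis using that by simp
    qed
    define X where "X = complex_of_real (c * s) * cinner (b i) (T (g j))"
    define Y where "Y = complex_of_real (s * c) * cinner (g i) (T (b j))"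
    define Z where "Z = complex_of_real (s * s) * (cinner (g i) (T (g j)) - \<mu> * cinner (b i) (b j))"
    have "cinner (V (b i)) (T (V (b j)))
      - (complex_of_real (c * c) * cinner (b i) (T (b j)) + complex_of_real (s * s) * \<mu> * cinner (b i) (b j))
      = X + Y + Z"
      by (simp add: X_def Y_def Z_def V(2) ij bounded_op_add[OF T] bounded_op_scaleC[OF T]
          cinner_add_left cinner_add_right cinner_scaleC_left cinner_scaleC_right algebra_simps)
    moreover have "cmod X < \<epsilon>" "cmod Y < \<epsilon>" "cmod Z < \<epsilon>"
      unfolding X_def Y_def Z_def
      by (rule small; use g[OF ij(1)] g[OF ij(2)] ij cs_le gTg[OF ij] in blast)+
    then have "cmod (X + Y + Z) < 3 * \<epsilon>"
      using norm_triangle_ineq[of "X + Y" Z] norm_triangle_ineq[of X Y] by linarith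
    ultimately show ?thesis unfolding cs by simp
  qed
  then show thesis using that V(1) by blast
qed

section \<open>Star-shapedness of the closed C-numerical range\<close>

text \<open>The unitary orbit of \<open>T\<close> accumulates weakly at \<open>(1 - t) T + t \<mu>\<close>, and the trace against
  \<open>C\<close> passes to the limit.\<close>

lemma trace_op_combination_in_closure:
  fixes C T :: "'a::complex_hilbert_space \<Rightarrow> 'a"
  assumes infinite_dim: "cinfinite_dimensional TYPE('a)"
    and separable: "separable_space (euclidean :: 'a topology)"
    and C: "trace_class C" and T: "bounded_op T"
    and \<mu>: "\<mu> \<in> essential_numerical_range T" and t: "t \<in> {0..1::real}"
  shows "complex_of_real t * (trace_op C * \<mu>) + complex_of_real (1 - t) * trace_op (C \<circ> T)
    \<in> closure (C_numerical_range C T)"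
proof -
  obtain B :: "'a set" where B: "orthonormal_basis B" using trace_class_basis[OF C] .
  obtain b where b: "orthonormal_basis_sequence b" "bij_betw b UNIV B"
    using orthonormal_basis_enumeration[OF infinite_dim separable B] by blast
  then have b': "orthonormal_sequence b" by (simp add: orthonormal_basis_sequence_def)
  define S where "S x = complex_of_real (1 - t) *\<^sub>C T x + (complex_of_real t * \<mu>) *\<^sub>C id x" for x
  \<comment> \<open>the \<open>n\<close>-th unitary controls the leading \<open>n\<close>-by-\<open>n\<close> block of the matrix up to \<open>3 / (n + 1)\<close>\<close>
  have "\<exists>V. unitary_op V \<and> (\<forall>i<n. \<forall>j<n. cmod (cinner (V (b i)) (T (V (b j))) - cinner (b i) (S (b j)))
      < 3 * (1 / real (Suc n)))" for n
    using rotated_matrix_entries[OF T \<mu> b' _ t, of "1 / real (Suc n)" n]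
    by (metis (no_types, lifting) S_def cinner_add_right cinner_scaleC_right id_apply of_nat_0_less_iff
        zero_less_Suc zero_less_divide_1_iff)
  then obtain V where V: "\<And>n. unitary_op (V n)"
    and entries: "\<And>n i j. \<lbrakk>i < n; j < n\<rbrakk> \<Longrightarrow> cmod (cinner (V n (b i)) (T (V n (b j))) - cinner (b i) (S (b j)))
      < 3 * (1 / real (Suc n))"
    by metis
  note V' = unitary_op_bounded[OF V]
  define A where "A n = adj (V n) \<circ> T \<circ> V n" for n
  obtain K where K: "\<And>x. norm (T x) \<le> K * norm x" using bounded_op_bound[OF T] by blast
  have "(\<lambda>n. trace_op (C \<circ> A n)) \<longlonglongrightarrow> trace_op (C \<circ> S)"
  proof (rule trace_op_weakly_continuous[OF infinite_dim separable C _ b(1)])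
    show "bounded_op S"
      unfolding S_def[abs_def] by (intro bounded_op_combination T bounded_op_id)
    show "bounded_op (A n)" for n
      unfolding A_def by (intro bounded_op_compose bounded_op_adj V' T)
    show "norm (A n x) \<le> K * norm x" for n x
    proof -
      have "norm (A n x) = norm (V n (A n x))" by (simp add: unitary_op_norm[OF V])
      also have "\<dots> = norm (T (V n x))" by (simp add: A_def unitary_op_adj_apply[OF V])
      also have "\<dots> \<le> K * norm x" using K[of "V n x"] by (simp add: unitary_op_norm[OF V])
      finally show ?thesis .
    qed
    show "(\<lambda>n. cinner (b i) (A n (b j))) \<longlonglongrightarrow> cinner (b i) (S (b j))" for i j
    proof (rule LIM_zero_cancel, rule Lim_null_comparison)
      show "\<forall>\<^sub>F n in sequentially. norm (cinner (b i) (A n (b j)) - cinner (b i) (S (b j)))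
          \<le> 3 * (1 / real (Suc n))"
        using entries by (intro eventually_sequentiallyI[of "Suc (max i j)"])
          (simp add: A_def cinner_adj_right[OF V'] less_imp_le)
      show "(\<lambda>n. 3 * (1 / real (Suc n))) \<longlonglongrightarrow> 0"
        using tendsto_mult_right_zero[OF LIMSEQ_inverse_real_of_nat, of 3] by (simp add: inverse_eq_divide)
    qed
  qed
  moreover have "trace_op (C \<circ> A n) \<in> C_numerical_range C T" for n
    unfolding C_numerical_range_def A_def using V by (auto simp: comp_assoc)
  ultimately have "trace_op (C \<circ> S) \<in> closure (C_numerical_range C T)"
    unfolding closure_sequential by (intro exI[of _ "\<lambda>n. trace_op (C \<circ> A n)"] conjI allI)
  moreover have "trace_op (C \<circ> S)
      = complex_of_real (1 - t) * trace_op (C \<circ> T) + complex_of_real t * \<mu> * trace_op (C \<circ> id)"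
    unfolding S_def[abs_def]
    by (rule trace_op_combination[OF infinite_dim separable C T bounded_op_id])
  ultimately show ?thesis by (simp add: algebra_simps)
qed

lemma essential_numerical_range_unitary:
  assumes U: "unitary_op U" and \<mu>: "\<mu> \<in> essential_numerical_range T"
  shows "\<mu> \<in> essential_numerical_range (adj U \<circ> T \<circ> U)"
proof -
  note U' = unitary_op_bounded[OF U]
  obtain f where f: "orthonormal_sequence f" "(\<lambda>n. cinner (f n) (T (f n))) \<longlonglongrightarrow> \<mu>"
    using \<mu> by (auto simp: essential_numerical_range_def)
  have "orthonormal_sequence (\<lambda>n. adj U (f n))"
    using f(1) by (simp add: orthonormal_sequence_def cinner_adj[OF U'] unitary_op_adj_apply[OF U])
  moreover have "(\<lambda>n. cinner (adj U (f n)) ((adj U \<circ> T \<circ> U) (adj U (f n)))) \<longlonglongrightarrow> \<mu>"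
    using f(2) by (simp add: cinner_adj[OF U'] unitary_op_adj_apply[OF U])
  ultimately show ?thesis unfolding essential_numerical_range_def by blast
qed

lemma C_numerical_range_unitary:
  assumes U: "unitary_op U"
  shows "C_numerical_range C (adj U \<circ> T \<circ> U) \<subseteq> C_numerical_range C T"
proof
  fix z assume "z \<in> C_numerical_range C (adj U \<circ> T \<circ> U)"
  then obtain V where V: "unitary_op V" and z: "z = trace_op (C \<circ> adj V \<circ> (adj U \<circ> T \<circ> U) \<circ> V)"
    by (auto simp: C_numerical_range_def)
  have "z = trace_op (C \<circ> adj (U \<circ> V) \<circ> T \<circ> (U \<circ> V))"
    unfolding z adj_compose[OF unitary_op_bounded[OF U] unitary_op_bounded[OF V]]
    by (simp add: comp_assoc)
  then show "z \<in> C_numerical_range C T"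
    unfolding C_numerical_range_def using unitary_op_compose[OF U V] by blast
qed

theorem theorem3p10:
  fixes C T :: "'a::complex_hilbert_space \<Rightarrow> 'a"
  assumes "cinfinite_dimensional TYPE('a)"
    and "separable_space (euclidean :: 'a topology)"
    and "trace_class C"
    and "bounded_op T"
  shows "\<forall>z \<in> {trace_op C * \<mu> | \<mu>. \<mu> \<in> essential_numerical_range T}.
           star_shaped_wrt (closure (C_numerical_range C T)) z"
proof (clarsimp simp: star_shaped_wrt_def simp del: of_real_diff)
  fix \<mu> a and t :: real
  assume \<mu>: "\<mu> \<in> essential_numerical_range T" and a: "a \<in> closure (C_numerical_range C T)"
    and t: "0 \<le> t" "t \<le> 1"
  \<comment> \<open>The contraction towards \<open>\<mu> tr(C)\<close> is continuous, so only points \<open>tr(C U\<^sup>\<dagger> T U)\<close> matter; for these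
    the unitary is absorbed into \<open>T\<close>, which changes neither \<open>W\<^sub>C(T)\<close> nor \<open>W\<^sub>e(T)\<close>.\<close>
  let ?f = "\<lambda>a. complex_of_real t * (trace_op C * \<mu>) + complex_of_real (1 - t) * a"
  have "?f ` closure (C_numerical_range C T) \<subseteq> closure (C_numerical_range C T)"
  proof (rule image_closure_subset)
    show "continuous_on (closure (C_numerical_range C T)) ?f" by (intro continuous_intros)
    show "?f ` C_numerical_range C T \<subseteq> closure (C_numerical_range C T)"
    proof clarify
      fix z assume "z \<in> C_numerical_range C T"
      then obtain U where U: "unitary_op U" and z: "z = trace_op (C \<circ> (adj U \<circ> T \<circ> U))"
        by (auto simp: C_numerical_range_def comp_assoc)
      have "bounded_op (adj U \<circ> T \<circ> U)"
        by (intro bounded_op_compose bounded_op_adj unitary_op_bounded[OF U] assms)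
      then have "?f z \<in> closure (C_numerical_range C (adj U \<circ> T \<circ> U))"
        unfolding z using t
        by (intro trace_op_combination_in_closure assms essential_numerical_range_unitary U \<mu>) auto
      then show "?f z \<in> closure (C_numerical_range C T)"
        using closure_mono[OF C_numerical_range_unitary[OF U]] by blast
    qed
  qed simp
  then show "complex_of_real t * (trace_op C * \<mu>) + complex_of_real (1 - t) * a
      \<in> closure (C_numerical_range C T)"
    using a by blast
qed

end
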